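(* Let $d,m\geq 2$ be integers, let $0<\varepsilon\leq 1$, and set $C:=\exp^{(2d)}\big(2^{8}\, m^{7(2d)^d}/\varepsilon^2\big)$, where $\exp^{(\ell)}$ is the $\ell$-th iterated exponential. Let $n\geq C$ be an integer, let $\mathcal{X}$ be a set with $|\mathcal{X}|=m$, let $\boldsymbol{X}=\langle X_s:s\in \binom{[n]}{d}\rangle$ be an $\mathcal{X}$-valued, $(1/C)$-spreadable, $d$-dimensional random array on $[n]$, and set $\delta_a:=\mathbb{P}\big([X_{[d]}=a]\big)$ for every $a\in\mathcal{X}$. Let $J,\Omega$ be nonempty finite sets with $|J|,|\Omega|\leq C$, let $\boldsymbol{\lambda}=\langle\lambda_j:j\in J\rangle$ be convex coefficients, and for every $j\in J$ let $\mu_j$ be a probability measure on $\Omega$ and $\mathcal{H}_j=\langle h^a_j:a\in\mathcal{X}\rangle$ an $\mathcal{X}$-partition of unity on $\Omega^d$ (with respect to $\mu_j$), such that for every $L\subseteq[n]$ with $|L|=2d$ the laws $P_L$ and $Q_L$ of the subarrays determined by $L$ of $\boldsymbol{X}$ and of the mixture array $\boldsymbol{X}_{\boldsymbol{\lambda},\boldsymbol{\mathcal{H}}}$ (defined in the context) satisfy $\rho_{\mathrm{TV}}(P_L,Q_L)\leq\varepsilon$. Then the following hold. (i) Let $\varrho>0$, and set $\vartheta:= 2^d (2\varepsilon+ 4\varrho)$. Assume that there is a subset $G$ of $J$ such that: (a) $\sum_{j\in G} \lambda_j\geq 1-\varrho$, and (b) for every $j\in G$ and every $a\in\mathcal{X}$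 we have $|\mathbb{E}[h^a_j]-\delta_a|\leq \varrho$ and $\big\|h^a_j-\mathbb{E}[h^a_j]\big\|_{\square}\leq \varrho$. Then $\boldsymbol{X}$ satisfies the $\vartheta$-box independence condition. (ii) Conversely, let $0<\vartheta \leq 1$, and set $\varrho:= 4m \big(\varepsilon^{1/16^d} + \vartheta^{1/16^d}\big)$. Assume that $\boldsymbol{X}$ satisfies the $\vartheta$-box independence condition. Then there exists a subset $G$ of $J$ such that: (a) $\sum_{j\in G} \lambda_j\geq 1-\varrho$, and (b) for every $j\in G$ and every $a\in\mathcal{X}$ we have $|\mathbb{E}[h^a_j]-\delta_a|\leq \varrho$ and $\big\|h^a_j-\mathbb{E}[h^a_j]\big\|_{\square}\leq \varrho$. (Here the expectation $\mathbb{E}[h^a_j]$ and the box norm of functions on $\Omega^d$ are taken with respect to $\mu_j$.)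
   Context: Notation: $\mathbb{N}=\{1,2,\dots\}$, $[n]=\{1,\dots,n\}$, $\binom{I}{d}$ is the set of all $d$-element subsets of $I$, $\rho_{\mathrm{TV}}$ is the total variation distance, $\exp^{(1)}(x)=\exp(x)$, $\exp^{(2)}(x)=\exp(\exp(x))$, etc. A $d$-dimensional random array on a set $I$ with $|I|\geq d$ is a stochastic process $\boldsymbol{X}=\langle X_s:s\in\binom{I}{d}\rangle$; for $J\subseteq I$ with $|J|\geq d$ the subarray determined by $J$ is $\boldsymbol{X}_J=\langle X_s:s\in\binom{J}{d}\rangle$. For $I\subseteq\mathbb{N}$ and $\eta\geq0$, $\boldsymbol{X}$ is $\eta$-spreadable if for all finite $J,K\subseteq I$ with $|J|=|K|\geq d$ the laws $P_J,P_K$ of $\boldsymbol{X}_J,\boldsymbol{X}_K$ (compared via the increasing bijection between $J$ and $K$) satisfy $\rho_{\mathrm{TV}}(P_J,P_K)\leq\eta$. An $\mathcal{X}$-partition of unity on $\Omega^d$ (with the product measure) is a collection $\langle h^a:a\in\mathcal{X}\rangle$ of $[0,1]$-valued random variables on $\Omega^d$ with $\sum_a h^a=1$ almost surely. Convex coefficients are positive reals summing to $1$. For $s=\{i_1<\dots<i_d\}\in\binom{\mathbb{N}}{d}$ and $\boldsymbol{\omega}\in\Omega^{\mathbb{N}}$ put $\boldsymbol{\omega}_s=(\omega_{i_1},\dots,\omega_{i_d})$; $\boldsymbol{\mu}_j$ is the product measure on $\Omega^{\mathbb{N}}$ induced by $\mu_j$. The mixture array $\boldsymbol{X}_{\boldsymbol{\lambda},\boldsymbol{\mathcal{H}}}$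 is the $\mathcal{X}$-valued, spreadable, $d$-dimensional random array on $\mathbb{N}$ whose distribution satisfies $$\mathbb{P}\Big(\bigcap_{s\in\mathcal{F}}[X^{\boldsymbol{\lambda},\boldsymbol{\mathcal{H}}}_s=a_s]\Big)=\sum_{j\in J}\lambda_j\int\prod_{s\in\mathcal{F}}h^{a_s}_j(\boldsymbol{\omega}_s)\,d\boldsymbol{\mu}_j(\boldsymbol{\omega})$$ for every nonempty finite $\mathcal{F}\subseteq\binom{\mathbb{N}}{d}$ and every $(a_s)_{s\in\mathcal{F}}$ in $\mathcal{X}$. Box norm: for $d\geq2$, a probability space $(\Omega,\mu)$ and an integrable $h\colon\Omega^d\to\mathbb{R}$, $$\|h\|_\square:=\Big(\int\prod_{\boldsymbol{\epsilon}\in\{0,1\}^d}h(\boldsymbol{\omega}_{\boldsymbol{\epsilon}})\,d\boldsymbol{\mu}(\boldsymbol{\omega})\Big)^{1/2^d},$$ where $\boldsymbol{\mu}$ is the product measure on $\Omega^{2d}$ and, for $\boldsymbol{\omega}=(\omega^0_1,\omega^1_1,\dots,\omega^0_d,\omega^1_d)$ and $\boldsymbol{\epsilon}=(\epsilon_1,\dots,\epsilon_d)$, $\boldsymbol{\omega}_{\boldsymbol{\epsilon}}=(\omega_1^{\epsilon_1},\dots,\omega_d^{\epsilon_d})$. Box independence: for $n\geq 2d$, a $d$-dimensional box of $[n]$ is a set of the form $\{s\in\binom{[n]}{d}:|s\cap H_i|=1\text{ for all }i\in[d]\}$, where $H_1,\dots,H_d$ are $2$-element subsets of $[n]$ with $\max(H_i)<\min(H_{i+1})$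 for every $i\in[d-1]$. For $\vartheta\geq0$, an $\mathcal{X}$-valued $d$-dimensional random array $\boldsymbol{X}$ on $[n]$ satisfies the $\vartheta$-box independence condition if there exists $\mathcal{S}\subseteq\mathcal{X}$ with $|\mathcal{S}|=|\mathcal{X}|-1$ such that for every $d$-dimensional box $B$ of $[n]$ and every $a\in\mathcal{S}$, $$\Big|\mathbb{P}\Big(\bigcap_{s\in B}[X_s=a]\Big)-\prod_{s\in B}\mathbb{P}\big([X_s=a]\big)\Big|\leq\vartheta.$$ *)

theory Defs
  imports "HOL-Probability.Probability"
begin

text \<open>Throughout, the natural numbers of the source are \<open>{1..}\<close>, and \<open>[n]\<close> is \<open>{1..n}\<close>.
  Points of a power \<open>\<Omega>^d\<close> are extensional functions on \<open>{..<d}\<close>, that is,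
  elements of the space of \<open>PiM {..<d} (\<lambda>_. \<mu>)\<close>; coordinates are thus counted from \<open>0\<close>.\<close>

definition d_subsets :: "nat \<Rightarrow> nat set \<Rightarrow> nat set set" where
  "d_subsets d I = {s. s \<subseteq> I \<and> finite s \<and> card s = d}"

definition total_variation :: "'a measure \<Rightarrow> 'a measure \<Rightarrow> real" where
  "total_variation P Q = (SUP A\<in>sets P. \<bar>measure P A - measure Q A\<bar>)"

text \<open>An array on \<open>I\<close> is a family indexed by all sets of naturals; only its values on
  \<open>d_subsets d I\<close> matter. The disjunction is \<open>|I| \<ge> d\<close>, as \<open>card\<close> is \<open>0\<close> on infinite sets.\<close>

definition random_array ::
    "'w measure \<Rightarrow> 'x set \<Rightarrow> nat \<Rightarrow> nat set \<Rightarrow> (nat set \<Rightarrow> 'w \<Rightarrow> 'x) \<Rightarrow> bool" where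
  "random_array M \<X> d I X \<longleftrightarrow>
     prob_space M \<and> (infinite I \<or> d \<le> card I) \<and>
     (\<forall>s\<in>d_subsets d I. X s \<in> M \<rightarrow>\<^sub>M count_space \<X>)"

definition subarray_law ::
    "'w measure \<Rightarrow> 'x set \<Rightarrow> nat \<Rightarrow> (nat set \<Rightarrow> 'w \<Rightarrow> 'x) \<Rightarrow> nat set \<Rightarrow> (nat set \<Rightarrow> 'x) measure" where
  "subarray_law M \<X> d X J =
     distr M (PiM (d_subsets d J) (\<lambda>_. count_space \<X>)) (\<lambda>w. \<lambda>s\<in>d_subsets d J. X s w)"

text \<open>The law of the subarray on \<open>K\<close> is transported to \<open>d_subsets d J\<close> along the
  unique increasing bijection \<open>\<phi>\<close> from \<open>J\<close> onto \<open>K\<close>.\<close>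

definition spreadable ::
    "'w measure \<Rightarrow> 'x set \<Rightarrow> nat \<Rightarrow> nat set \<Rightarrow> real \<Rightarrow> (nat set \<Rightarrow> 'w \<Rightarrow> 'x) \<Rightarrow> bool" where
  "spreadable M \<X> d I \<eta> X \<longleftrightarrow>
     (\<forall>J K \<phi>. J \<subseteq> I \<and> K \<subseteq> I \<and> finite J \<and> finite K \<and> card J = card K \<and> d \<le> card J \<and>
        strict_mono_on J \<phi> \<and> \<phi> ` J = K \<longrightarrow>
        total_variation (subarray_law M \<X> d X J)
          (subarray_law M \<X> d (\<lambda>s. X (\<phi> ` s)) J) \<le> \<eta>)"

definition partition_of_unity ::
    "'x set \<Rightarrow> nat \<Rightarrow> 'o measure \<Rightarrow> ('x \<Rightarrow> (nat \<Rightarrow> 'o) \<Rightarrow> real) \<Rightarrow> bool" where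
  "partition_of_unity \<X> d \<mu> h \<longleftrightarrow>
     (\<forall>a\<in>\<X>. h a \<in> borel_measurable (PiM {..<d} (\<lambda>_. \<mu>)) \<and>
        (\<forall>w\<in>space (PiM {..<d} (\<lambda>_. \<mu>)). 0 \<le> h a w \<and> h a w \<le> 1)) \<and>
     (AE w in PiM {..<d} (\<lambda>_. \<mu>). (\<Sum>a\<in>\<X>. h a w) = 1)"

text \<open>The point \<open>(w i\<^sub>1, \<dots>, w i\<^sub>d)\<close> for \<open>s = {i\<^sub>1 < \<dots> < i\<^sub>d}\<close>.\<close>

definition restrict_along :: "nat \<Rightarrow> (nat \<Rightarrow> 'o) \<Rightarrow> nat set \<Rightarrow> nat \<Rightarrow> 'o" where
  "restrict_along d w s = (\<lambda>k\<in>{..<d}. w (sorted_list_of_set s ! k))"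

text \<open>The formula determines the law of the array, so a mixture array is unique up to its
  realisation; the predicate holds of every realisation \<open>Y\<close> on a probability space \<open>N\<close>.\<close>

definition mixture_array ::
    "'v measure \<Rightarrow> 'x set \<Rightarrow> nat \<Rightarrow> 'j set \<Rightarrow> ('j \<Rightarrow> real) \<Rightarrow> ('j \<Rightarrow> 'o measure) \<Rightarrow>
     ('j \<Rightarrow> 'x \<Rightarrow> (nat \<Rightarrow> 'o) \<Rightarrow> real) \<Rightarrow> (nat set \<Rightarrow> 'v \<Rightarrow> 'x) \<Rightarrow> bool" where
  "mixture_array N \<X> d J lam \<mu> h Y \<longleftrightarrow>
     random_array N \<X> d {1..} Y \<and> spreadable N \<X> d {1..} 0 Y \<and>
     (\<forall>F a. finite F \<and> F \<noteq> {} \<and> F \<subseteq> d_subsets d {1..} \<and> (\<forall>s\<in>F. a s \<in> \<X>) \<longrightarrow>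
        measure N {v\<in>space N. \<forall>s\<in>F. Y s v = a s} =
        (\<Sum>j\<in>J. lam j *
           (\<integral>w. (\<Prod>s\<in>F. h j (a s) (restrict_along d w s)) \<partial>PiM {1..} (\<lambda>_. \<mu> j))))"

definition expect :: "nat \<Rightarrow> 'o measure \<Rightarrow> ((nat \<Rightarrow> 'o) \<Rightarrow> real) \<Rightarrow> real" where
  "expect d \<mu> f = (\<integral>w. f w \<partial>PiM {..<d} (\<lambda>_. \<mu>))"

text \<open>The coordinate \<open>\<omega>\<^sub>i\<^sup>\<epsilon>\<close> of a point of \<open>\<Omega>^(2d)\<close> has index \<open>(i, \<epsilon>)\<close>,
  with \<open>\<epsilon>\<close> boolean.\<close>

definition box_norm :: "nat \<Rightarrow> 'o measure \<Rightarrow> ((nat \<Rightarrow> 'o) \<Rightarrow> real) \<Rightarrow> real" where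
  "box_norm d \<mu> f =
     root (2 ^ d)
       (\<integral>w. (\<Prod>e\<in>{..<d} \<rightarrow>\<^sub>E (UNIV :: bool set). f (\<lambda>i\<in>{..<d}. w (i, e i)))
          \<partial>PiM ({..<d} \<times> (UNIV :: bool set)) (\<lambda>_. \<mu>))"

definition is_box :: "nat \<Rightarrow> nat \<Rightarrow> nat set set \<Rightarrow> bool" where
  "is_box d n B \<longleftrightarrow>
     (\<exists>H :: nat \<Rightarrow> nat set.
        (\<forall>i\<in>{1..d}. H i \<subseteq> {1..n} \<and> card (H i) = 2) \<and>
        (\<forall>i\<in>{1..<d}. Max (H i) < Min (H (i + 1))) \<and>
        B = {s \<in> d_subsets d {1..n}. \<forall>i\<in>{1..d}. card (s \<inter> H i) = 1})"

definition box_independent ::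
    "'w measure \<Rightarrow> 'x set \<Rightarrow> nat \<Rightarrow> nat \<Rightarrow> real \<Rightarrow> (nat set \<Rightarrow> 'w \<Rightarrow> 'x) \<Rightarrow> bool" where
  "box_independent M \<X> d n \<theta> X \<longleftrightarrow>
     (\<exists>S\<subseteq>\<X>. card S = card \<X> - 1 \<and>
        (\<forall>B a. is_box d n B \<and> a \<in> S \<longrightarrow>
           \<bar>measure M {w\<in>space M. \<forall>s\<in>B. X s w = a}
             - (\<Prod>s\<in>B. measure M {w\<in>space M. X s w = a})\<bar> \<le> \<theta>))"

end

theory Submission imports Defs begin

text \<open>
Fix a value \<open>a\<close> and put \<open>D = 2 ^ d\<close>. In the component \<open>j\<close> of the mixture, an entry equals \<open>a\<close> with
probability \<open>c\<^sub>j\<close>, the mean of \<open>h\<^sub>j\<close>, and all \<open>D\<close> entries of a box equal \<open>a\<close> with probability \<open>b\<^sub>j\<close>, the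
\<open>D\<close>-th power of the box norm of \<open>h\<^sub>j\<close>. A box lies within \<open>2d\<close> indices, so up to multiples of \<open>\<epsilon>\<close>
an entry of \<open>X\<close> equals \<open>a\<close> with probability \<open>c = \<Sum> \<lambda>\<^sub>j c\<^sub>j\<close>, and a box of \<open>X\<close> is constantly \<open>a\<close> with
probability \<open>\<Sum> \<lambda>\<^sub>j b\<^sub>j\<close> (\<open>box_near\<close>). Box independence thus asks whether \<open>\<Sum> \<lambda>\<^sub>j b\<^sub>j\<close> is close to \<open>c ^ D\<close>.

If most components have \<open>c\<^sub>j\<close> close to \<open>\<delta>\<close> and \<open>h\<^sub>j - c\<^sub>j\<close> of small box norm, then replacing \<open>h\<^sub>j\<close> by \<open>c\<^sub>j\<close> at
one vertex of the box after the other shows that \<open>b\<^sub>j\<close> is close to \<open>c\<^sub>j ^ D\<close>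
(\<open>box_form_near_mean_power\<close>), and averaging gives (i). All estimates of this kind come from the
Gowers--Cauchy--Schwarz inequality (\<open>gowers_cauchy_schwarz\<close>).

For (ii), \<open>c\<^sub>j ^ D \<le> b\<^sub>j\<close> holds always, so box independence means near equality in
\<open>c ^ D \<le> \<Sum> \<lambda>\<^sub>j c\<^sub>j ^ D \<le> \<Sum> \<lambda>\<^sub>j b\<^sub>j\<close>. A quantitative version of Jensen's inequality
(\<open>concentration_of_power_means\<close>) yields that, outside a set of small weight, \<open>c\<^sub>j\<close> is close to \<open>c\<close>
and \<open>b\<^sub>j\<close> is close to \<open>c\<^sub>j ^ D\<close>. It remains to see that a function whose box form is nearly as small
as its mean permits is quasirandom (\<open>box_form_centred_le\<close>). The box form of \<open>h\<^sub>j - c\<^sub>j\<close> expands into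
the counts of \<open>h\<^sub>j\<close> on the subsets \<open>T\<close> of the vertices of a box, and vanishes if each of these counts
is replaced by \<open>c\<^sub>j ^ card T\<close>. Upper bounds for the counts follow from Gowers--Cauchy--Schwarz; they
imply the lower bounds by a second moment argument along the directions of the cube
(\<open>subbox_count_near\<close>). The value that box independence omits is recovered from the partition of
unity and the triangle inequality for the box norm.
\<close>

section \<open>Integration on finite powers of a finite probability space\<close>

locale finite_prob_space = prob_space \<mu> for \<mu> :: "'o measure" +
  assumes finite_space: "finite (space \<mu>)"
    and discrete: "sets \<mu> = Pow (space \<mu>)"
begin

lemma prob_space_power: "prob_space (PiM K (\<lambda>_. \<mu>))"
  by (intro prob_space_PiM prob_space_axioms)

lemma finite_space_power: "finite K \<Longrightarrow> finite (space (PiM K (\<lambda>_. \<mu>)))"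
  by (simp add: space_PiM finite_PiE finite_space)

lemma singleton_in_sets_power:
  assumes "finite K" and v: "v \<in> space (PiM K (\<lambda>_. \<mu>))"
  shows "{v} \<in> sets (PiM K (\<lambda>_. \<mu>))"
proof -
  have "{v} = (\<Pi>\<^sub>E k\<in>K. {v k})"
    using v by (auto simp: space_PiM PiE_iff extensional_def intro!: ext)
  also have "\<dots> \<in> sets (PiM K (\<lambda>_. \<mu>))"
    using assms by (intro sets_PiM_I_finite) (auto simp: discrete space_PiM)
  finally show ?thesis .
qed

text \<open>Finitely many points, all of them measurable: every function on a finite power is measurable
and integrable, so integrals over finite powers are manipulated like finite sums.\<close>

lemma sets_power:
  assumes "finite K"
  shows "sets (PiM K (\<lambda>_. \<mu>)) = Pow (space (PiM K (\<lambda>_. \<mu>)))"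
proof (intro equalityI subsetI)
  fix A assume "A \<in> Pow (space (PiM K (\<lambda>_. \<mu>)))"
  then have A: "A \<subseteq> space (PiM K (\<lambda>_. \<mu>))" by simp
  then have "(\<Union>v\<in>A. {v}) \<in> sets (PiM K (\<lambda>_. \<mu>))"
    using finite_subset[OF A finite_space_power[OF assms]] singleton_in_sets_power[OF assms]
    by (intro sets.finite_UN) auto
  then show "A \<in> sets (PiM K (\<lambda>_. \<mu>))" by simp
qed (use sets.sets_into_space in auto)

lemma measurable_power [simp]:
  "finite K \<Longrightarrow> f \<in> borel_measurable (PiM K (\<lambda>_. \<mu>))"
  by (auto simp: measurable_def sets_power)

lemma integrable_power [simp]:
  fixes f :: "('k \<Rightarrow> 'o) \<Rightarrow> real"
  assumes "finite K"
  shows "integrable (PiM K (\<lambda>_. \<mu>)) f"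
proof -
  interpret P: prob_space "PiM K (\<lambda>_. \<mu>)" by (rule prob_space_power)
  let ?B = "\<Sum>v\<in>space (PiM K (\<lambda>_. \<mu>)). \<bar>f v\<bar>"
  have "norm (f v) \<le> ?B" if "v \<in> space (PiM K (\<lambda>_. \<mu>))" for v
    using member_le_sum[of v "space (PiM K (\<lambda>_. \<mu>))" "\<lambda>v. \<bar>f v\<bar>"]
      finite_space_power[OF assms] that by auto
  then show ?thesis
    using assms by (intro P.integrable_const_bound[where B="?B"]) auto
qed

lemma measurable_base [simp]: "f \<in> borel_measurable \<mu>"
  by (auto simp: measurable_def discrete)

lemma integrable_base [simp]:
  fixes f :: "'o \<Rightarrow> real"
  shows "integrable \<mu> f"
proof -
  have "norm (f v) \<le> (\<Sum>v\<in>space \<mu>. \<bar>f v\<bar>)" if "v \<in> space \<mu>" for v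
    using member_le_sum[of v "space \<mu>" "\<lambda>v. \<bar>f v\<bar>"] finite_space that by auto
  then show ?thesis
    by (intro integrable_const_bound[where B="\<Sum>v\<in>space \<mu>. \<bar>f v\<bar>"]) auto
qed

lemma integral_const_power [simp]: "(\<integral>w. c \<partial>PiM K (\<lambda>_. \<mu>)) = (c::real)"
proof -
  interpret P: prob_space "PiM K (\<lambda>_. \<mu>)" by (rule prob_space_power)
  show ?thesis by (simp add: P.prob_space)
qed

lemma measure_space_power [simp]: "measure (PiM K (\<lambda>_. \<mu>)) (space (PiM K (\<lambda>_. \<mu>))) = 1"
  by (rule prob_space.prob_space) (rule prob_space_power)

lemma integral_insert_power:
  fixes f :: "('k \<Rightarrow> 'o) \<Rightarrow> real"
  assumes "finite K" and "k \<notin> K"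
  shows "(\<integral>w. f w \<partial>PiM (insert k K) (\<lambda>_. \<mu>)) = (\<integral>w. (\<integral>x. f (w(k := x)) \<partial>\<mu>) \<partial>PiM K (\<lambda>_. \<mu>))"
proof -
  interpret product_sigma_finite "\<lambda>_ :: 'k. \<mu>"
    by (rule product_sigma_finite.intro, rule sigma_finite_measure_axioms)
  show ?thesis using assms by (intro product_integral_insert) auto
qed

text \<open>Only finitely many coordinates of an infinite power are ever inspected, so that
  integrals over it reduce to integrals over a finite power, where everything is
  integrable.\<close>

lemma integral_reindex_power:
  fixes f :: "('k \<Rightarrow> 'o) \<Rightarrow> real"
  assumes "finite K" and "inj_on \<pi> K" and "\<pi> \<in> K \<rightarrow> L"
  shows "(\<integral>w. f (\<lambda>k\<in>K. w (\<pi> k)) \<partial>PiM L (\<lambda>_. \<mu>)) = (\<integral>w. f w \<partial>PiM K (\<lambda>_. \<mu>))"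
proof -
  have "(\<integral>w. f w \<partial>PiM K (\<lambda>_. \<mu>))
      = (\<integral>w. f w \<partial>distr (PiM L (\<lambda>_. \<mu>)) (PiM K (\<lambda>_. \<mu>)) (\<lambda>w. \<lambda>k\<in>K. w (\<pi> k)))"
    using distr_PiM_reindex[of L "\<lambda>_. \<mu>" \<pi> K] assms prob_space_axioms by simp
  also have "\<dots> = (\<integral>w. f (\<lambda>k\<in>K. w (\<pi> k)) \<partial>PiM L (\<lambda>_. \<mu>))"
    using assms by (intro integral_distr measurable_restrict measurable_component_singleton) auto
  finally show ?thesis by simp
qed

lemma integral_power_mono:
  fixes f g :: "('k \<Rightarrow> 'o) \<Rightarrow> real"
  assumes "finite K" and "\<And>w. w \<in> space (PiM K (\<lambda>_. \<mu>)) \<Longrightarrow> f w \<le> g w"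
  shows "(\<integral>w. f w \<partial>PiM K (\<lambda>_. \<mu>)) \<le> (\<integral>w. g w \<partial>PiM K (\<lambda>_. \<mu>))"
  using assms by (intro integral_mono) auto

lemma cauchy_schwarz_power:
  fixes f g :: "('k \<Rightarrow> 'o) \<Rightarrow> real"
  assumes K: "finite K"
  shows "(\<integral>w. f w * g w \<partial>PiM K (\<lambda>_. \<mu>))\<^sup>2
    \<le> (\<integral>w. f w * f w \<partial>PiM K (\<lambda>_. \<mu>)) * (\<integral>w. g w * g w \<partial>PiM K (\<lambda>_. \<mu>))"
proof -
  let ?E = "\<lambda>u :: ('k \<Rightarrow> 'o) \<Rightarrow> real. \<integral>w. u w \<partial>PiM K (\<lambda>_. \<mu>)"
  define a where "a = ?E (\<lambda>w. f w * f w)"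
  define b where "b = ?E (\<lambda>w. f w * g w)"
  define c where "c = ?E (\<lambda>w. g w * g w)"
  have quad: "0 \<le> s\<^sup>2 * a - 2 * s * t * b + t\<^sup>2 * c" for s t
  proof -
    have "0 \<le> ?E (\<lambda>w. (s * f w - t * g w)\<^sup>2)"
      by (intro integral_nonneg_AE) auto
    also have "?E (\<lambda>w. (s * f w - t * g w)\<^sup>2)
        = ?E (\<lambda>w. s\<^sup>2 * (f w * f w) - 2 * s * t * (f w * g w) + t\<^sup>2 * (g w * g w))"
      by (intro Bochner_Integration.integral_cong) (auto simp: power2_eq_square algebra_simps)
    also have "\<dots> = s\<^sup>2 * a - 2 * s * t * b + t\<^sup>2 * c"
      using K by (simp add: a_def b_def c_def)
    finally show ?thesis .
  qed
  have a0: "0 \<le> a" and c0: "0 \<le> c"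
    unfolding a_def c_def by (intro integral_nonneg_AE; simp)+
  have "b\<^sup>2 \<le> a * c"
  proof (cases "a = 0")
    case True
    \<comment> \<open>Without its leading term the quadratic form is linear in \<open>s\<close>; the point \<open>(c + 1, b)\<close> makes it negative unless \<open>b = 0\<close>.\<close>
    have "(c + 2) * b\<^sup>2 \<le> 0"
      using quad[of "c + 1" b] True by (simp add: power2_eq_square algebra_simps)
    then have "b\<^sup>2 \<le> 0"
      using c0 by (simp add: mult_le_0_iff)
    then show ?thesis using True by simp
  next
    case False
    have "0 \<le> a * (a * c - b\<^sup>2)"
      using quad[of b a] by (simp add: power2_eq_square algebra_simps)
    then show ?thesis using False a0 by (simp add: zero_le_mult_iff)
  qed
  then show ?thesis by (simp add: a_def b_def c_def)
qed

end

section \<open>The box form and its Cauchy--Schwarz inequality\<close>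

lemma prod_funcset_insert:
  assumes "finite I" and "i \<in> I"
  shows "(\<Prod>e\<in>I \<rightarrow>\<^sub>E (UNIV :: bool set). \<phi> e :: 'a :: comm_monoid_mult)
    = (\<Prod>e\<in>(I - {i}) \<rightarrow>\<^sub>E UNIV. \<phi> (e(i := False))) * (\<Prod>e\<in>(I - {i}) \<rightarrow>\<^sub>E UNIV. \<phi> (e(i := True)))"
proof -
  have I: "I = insert i (I - {i})" using assms by auto
  have inj: "inj_on (\<lambda>(y :: bool, g). g(i := y)) (UNIV \<times> ((I - {i}) \<rightarrow>\<^sub>E UNIV))"
    by (rule inj_combinator) simp
  have "(\<Prod>e\<in>I \<rightarrow>\<^sub>E (UNIV :: bool set). \<phi> e)
      = (\<Prod>(y, g)\<in>UNIV \<times> ((I - {i}) \<rightarrow>\<^sub>E UNIV). \<phi> (g(i := y)))"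
    by (subst I, subst PiE_insert_eq, subst prod.reindex[OF inj]) (auto intro!: prod.cong)
  also have "\<dots> = (\<Prod>y\<in>(UNIV :: bool set). \<Prod>g\<in>(I - {i}) \<rightarrow>\<^sub>E UNIV. \<phi> (g(i := y)))"
    by (rule prod.cartesian_product[symmetric])
  finally show ?thesis by (simp add: UNIV_bool mult.commute)
qed

context finite_prob_space
begin

text \<open>The multilinear form behind the box norm: each vertex \<open>e\<close> of the cube \<open>{0,1}^I\<close> carries its own
function, evaluated at the corresponding vertex of a random box. The box norm is the case of
equal functions; different functions at different vertices are what makes Cauchy--Schwarz,
hybrid arguments and sub-box counts expressible.\<close>

definition box_form :: "'i set \<Rightarrow> (('i \<Rightarrow> bool) \<Rightarrow> ('i \<Rightarrow> 'o) \<Rightarrow> real) \<Rightarrow> real" where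
  "box_form I F = (\<integral>w. (\<Prod>e\<in>I \<rightarrow>\<^sub>E UNIV. F e (\<lambda>i\<in>I. w (i, e i))) \<partial>PiM (I \<times> UNIV) (\<lambda>_. \<mu>))"

text \<open>The mean over the value \<open>x\<close> of coordinate \<open>i\<close> of the product over one facet of the cube. The
vertices of the facet are indexed by the cube on \<open>I - {i}\<close>, so that the two opposite facets
\<open>e i = False\<close> and \<open>e i = True\<close> become two inputs of the same functional.\<close>

definition face_mean :: "'i set \<Rightarrow> 'i \<Rightarrow> (('i \<Rightarrow> bool) \<Rightarrow> ('i \<Rightarrow> 'o) \<Rightarrow> real) \<Rightarrow> ('i \<times> bool \<Rightarrow> 'o) \<Rightarrow> real"
  where "face_mean I i G w
    = (\<integral>x. (\<Prod>e\<in>(I - {i}) \<rightarrow>\<^sub>E UNIV. G e (\<lambda>k\<in>I. if k = i then x else w (k, e k))) \<partial>\<mu>)"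

lemma box_point_in_space:
  "w \<in> space (PiM (I \<times> UNIV) (\<lambda>_. \<mu>)) \<Longrightarrow> (\<lambda>i\<in>I. w (i, e i)) \<in> space (PiM I (\<lambda>_. \<mu>))"
  by (auto simp: space_PiM PiE_iff)

lemma box_form_cong:
  assumes "\<And>e v. e \<in> I \<rightarrow>\<^sub>E UNIV \<Longrightarrow> v \<in> space (PiM I (\<lambda>_. \<mu>)) \<Longrightarrow> F e v = G e v"
  shows "box_form I F = box_form I G"
  unfolding box_form_def
  by (intro Bochner_Integration.integral_cong prod.cong refl assms box_point_in_space) auto

text \<open>A vertex of a box sees exactly one of the two values of coordinate \<open>i\<close>. Hence, given the other
coordinates, the products over the two opposite facets are independent, and the box form is
the integral of a product of two facet means.\<close>

lemma box_form_split:
  assumes I: "finite I" and i: "i \<in> I"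
  shows "box_form I F = (\<integral>w. face_mean I i (\<lambda>e. F (e(i := False))) w
      * face_mean I i (\<lambda>e. F (e(i := True))) w \<partial>PiM ((I - {i}) \<times> UNIV) (\<lambda>_. \<mu>))"
proof -
  let ?R = "(I - {i}) \<times> (UNIV :: bool set)" and ?C = "(I - {i}) \<rightarrow>\<^sub>E (UNIV :: bool set)"
  have ins: "I \<times> (UNIV :: bool set) = insert (i, False) (insert (i, True) ?R)"
    using i by (auto simp: UNIV_bool)
  define U where "U b x w = (\<Prod>e\<in>?C. F (e(i := b)) (\<lambda>k\<in>I. if k = i then x else w (k, e k)))" for b x w
  have prod_eq: "(\<Prod>e\<in>I \<rightarrow>\<^sub>E UNIV. F e (\<lambda>k\<in>I. (w((i, True) := y, (i, False) := x)) (k, e k)))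
      = U False x w * U True y w" for w x y
    unfolding prod_funcset_insert[OF I i] U_def
    by (intro arg_cong2[where f="(*)"] prod.cong refl arg_cong2[where f=F]) (auto intro!: arg_cong2[where f=F] simp: restrict_def fun_eq_iff)
  have "box_form I F
      = (\<integral>w. (\<integral>x. (\<Prod>e\<in>I \<rightarrow>\<^sub>E UNIV. F e (\<lambda>k\<in>I. (w((i, False) := x)) (k, e k))) \<partial>\<mu>)
          \<partial>PiM (insert (i, True) ?R) (\<lambda>_. \<mu>))"
    unfolding box_form_def ins by (rule integral_insert_power) (use I in auto)
  also have "\<dots> = (\<integral>w. (\<integral>y. (\<integral>x. U False x w * U True y w \<partial>\<mu>) \<partial>\<mu>) \<partial>PiM ?R (\<lambda>_. \<mu>))"
    by (subst integral_insert_power) (use I in \<open>auto simp: prod_eq simp del: fun_upd_apply\<close>)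
  also have "\<dots> = (\<integral>w. (\<integral>x. U False x w \<partial>\<mu>) * (\<integral>y. U True y w \<partial>\<mu>) \<partial>PiM ?R (\<lambda>_. \<mu>))"
    by simp
  finally show ?thesis by (simp add: face_mean_def U_def)
qed

lemma box_form_face_eq_square:
  assumes "finite I" and "i \<in> I"
  shows "box_form I (\<lambda>e. F (e(i := b)))
    = (\<integral>w. face_mean I i (\<lambda>e. F (e(i := b))) w * face_mean I i (\<lambda>e. F (e(i := b))) w
        \<partial>PiM ((I - {i}) \<times> UNIV) (\<lambda>_. \<mu>))"
  by (subst box_form_split[OF assms]) simp

text \<open>Replacing both facets by one of them turns the product of facet means into a square, so this
is ordinary Cauchy--Schwarz after splitting off coordinate \<open>i\<close>.\<close>

lemma box_form_cauchy_schwarz: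
  assumes "finite I" and "i \<in> I"
  shows "(box_form I F)\<^sup>2 \<le> box_form I (\<lambda>e. F (e(i := False))) * box_form I (\<lambda>e. F (e(i := True)))"
  unfolding box_form_face_eq_square[OF assms] box_form_split[OF assms, of F]
  by (rule cauchy_schwarz_power) (use assms in auto)

lemma box_form_const_nonneg:
  assumes "finite I" and "i \<in> I"
  shows "0 \<le> box_form I (\<lambda>_. f)"
  unfolding box_form_face_eq_square[OF assms, of "\<lambda>_. f"]
  by (intro integral_nonneg_AE) auto

text \<open>Each use of Cauchy--Schwarz in a further coordinate doubles the exponent and overrides that
coordinate of the vertex label by both possible values \<open>b\<close>.\<close>

lemma box_form_cauchy_schwarz_iterated:
  assumes "finite I" and "K \<subseteq> I"
  shows "\<bar>box_form I F\<bar> ^ (2 ^ card K)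
    \<le> (\<Prod>b\<in>K \<rightarrow>\<^sub>E UNIV. \<bar>box_form I (\<lambda>e. F (override_on e b K))\<bar>)"
  using finite_subset[OF assms(2,1)] assms(2)
proof (induction K rule: finite_induct)
  case empty
  then show ?case by simp
next
  case (insert i K)
  let ?G = "\<lambda>b e. F (override_on e b K)"
  have step: "\<bar>box_form I (?G b)\<bar>\<^sup>2
      \<le> \<bar>box_form I (\<lambda>e. ?G b (e(i := False)))\<bar> * \<bar>box_form I (\<lambda>e. ?G b (e(i := True)))\<bar>" for b
    using box_form_cauchy_schwarz[OF assms(1), of i "?G b"] insert.prems
    by (simp add: abs_mult[symmetric])
  have upd: "override_on (e(i := c)) b K = override_on e (b(i := c)) (insert i K)" for e c b
    using insert.hyps by (auto simp: override_on_def fun_eq_iff)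
  have "\<bar>box_form I F\<bar> ^ (2 ^ card (insert i K)) = (\<bar>box_form I F\<bar> ^ (2 ^ card K))\<^sup>2"
    using insert.hyps by (simp add: power_mult[symmetric] mult.commute)
  also have "\<dots> \<le> (\<Prod>b\<in>K \<rightarrow>\<^sub>E UNIV. \<bar>box_form I (?G b)\<bar>)\<^sup>2"
    using insert by (intro power_mono) auto
  also have "\<dots> = (\<Prod>b\<in>K \<rightarrow>\<^sub>E UNIV. \<bar>box_form I (?G b)\<bar>\<^sup>2)"
    by (simp add: prod_power_distrib)
  also have "\<dots> \<le> (\<Prod>b\<in>K \<rightarrow>\<^sub>E UNIV. \<bar>box_form I (\<lambda>e. ?G b (e(i := False)))\<bar>
      * \<bar>box_form I (\<lambda>e. ?G b (e(i := True)))\<bar>)"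
    by (intro prod_mono) (use step in auto)
  also have "\<dots> = (\<Prod>b\<in>insert i K \<rightarrow>\<^sub>E UNIV. \<bar>box_form I (\<lambda>e. F (override_on e b (insert i K)))\<bar>)"
    using insert.hyps
    by (subst prod_funcset_insert[of "insert i K" i]) (auto simp: upd prod.distrib)
  finally show ?case .
qed

end

section \<open>The box norm\<close>

context finite_prob_space
begin

text \<open>The box norm over an arbitrary finite index set, which lets the lemmas about it be proved
without referring to the order of the coordinates.\<close>

definition box_root :: "'i set \<Rightarrow> (('i \<Rightarrow> 'o) \<Rightarrow> real) \<Rightarrow> real" where
  "box_root I f = root (2 ^ card I) (box_form I (\<lambda>_. f))"

lemma card_cube: "finite I \<Longrightarrow> card (I \<rightarrow>\<^sub>E (UNIV :: bool set)) = 2 ^ card I"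
  by (simp add: card_funcsetE)

lemma finite_cube: "finite I \<Longrightarrow> finite (I \<rightarrow>\<^sub>E (UNIV :: bool set))"
  by (simp add: finite_PiE)

lemma box_root_nonneg: "finite I \<Longrightarrow> i \<in> I \<Longrightarrow> 0 \<le> box_root I f"
  unfolding box_root_def using box_form_const_nonneg[of I i f] by simp

lemma box_root_power: "finite I \<Longrightarrow> i \<in> I \<Longrightarrow> box_root I f ^ 2 ^ card I = box_form I (\<lambda>_. f)"
  unfolding box_root_def by (simp add: box_form_const_nonneg)

text \<open>The Gowers--Cauchy--Schwarz inequality: once Cauchy--Schwarz was applied in every coordinate,
all vertices of the form labelled \<open>b\<close> carry the same function \<open>F b\<close>.\<close>

lemma gowers_cauchy_schwarz:
  assumes I: "finite I" "i \<in> I"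
  shows "\<bar>box_form I F\<bar> \<le> (\<Prod>e\<in>I \<rightarrow>\<^sub>E UNIV. box_root I (F e))"
proof -
  have ov: "override_on e b I = b" if "e \<in> I \<rightarrow>\<^sub>E UNIV" "b \<in> I \<rightarrow>\<^sub>E UNIV" for e b :: "_ \<Rightarrow> bool"
    using that by (auto simp: override_on_def fun_eq_iff PiE_iff extensional_def)
  have "\<bar>box_form I F\<bar> ^ (2 ^ card I)
      \<le> (\<Prod>b\<in>I \<rightarrow>\<^sub>E UNIV. \<bar>box_form I (\<lambda>e. F (override_on e b I))\<bar>)"
    by (rule box_form_cauchy_schwarz_iterated) (use I in auto)
  also have "\<dots> = (\<Prod>b\<in>I \<rightarrow>\<^sub>E UNIV. box_root I (F b) ^ (2 ^ card I))"
  proof (rule prod.cong[OF refl])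
    fix b :: "_ \<Rightarrow> bool" assume b: "b \<in> I \<rightarrow>\<^sub>E UNIV"
    have "box_form I (\<lambda>e. F (override_on e b I)) = box_form I (\<lambda>_. F b)"
      by (rule box_form_cong) (simp add: ov b)
    then show "\<bar>box_form I (\<lambda>e. F (override_on e b I))\<bar> = box_root I (F b) ^ (2 ^ card I)"
      using I by (simp add: box_root_power box_form_const_nonneg)
  qed
  also have "\<dots> = (\<Prod>b\<in>I \<rightarrow>\<^sub>E UNIV. box_root I (F b)) ^ (2 ^ card I)"
    by (simp add: prod_power_distrib)
  finally show ?thesis
    by (rule power_le_imp_le_base[where n="2 ^ card I - 1", simplified])
      (intro prod_nonneg ballI box_root_nonneg[OF I])
qed

lemma box_form_constants:
  "finite I \<Longrightarrow> box_form I (\<lambda>e _. k e) = (\<Prod>e\<in>I \<rightarrow>\<^sub>E UNIV. k e)"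
  by (simp add: box_form_def)

lemma box_form_one_slot:
  assumes I: "finite I" and e0: "e0 \<in> I \<rightarrow>\<^sub>E UNIV"
  shows "box_form I (\<lambda>e. if e = e0 then f else (\<lambda>_. k))
    = k ^ (2 ^ card I - 1) * (\<integral>v. f v \<partial>PiM I (\<lambda>_. \<mu>))"
proof -
  let ?C = "I \<rightarrow>\<^sub>E (UNIV :: bool set)"
  have "(\<Prod>e\<in>?C. (if e = e0 then f else (\<lambda>_. k)) (\<lambda>i\<in>I. w (i, e i)))
      = k ^ (2 ^ card I - 1) * f (\<lambda>i\<in>I. w (i, e0 i))" for w
  proof -
    have "(\<Prod>e\<in>?C - {e0}. (if e = e0 then f else (\<lambda>_. k)) (\<lambda>i\<in>I. w (i, e i))) = (\<Prod>e\<in>?C - {e0}. k)"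
      by (rule prod.cong) auto
    also have "\<dots> = k ^ (2 ^ card I - 1)"
      using e0 I by (simp add: card_cube finite_cube)
    finally show ?thesis
      using e0 I by (subst prod.remove[of _ e0]) (auto simp: finite_cube)
  qed
  then have "box_form I (\<lambda>e. if e = e0 then f else (\<lambda>_. k))
      = k ^ (2 ^ card I - 1) * (\<integral>w. f (\<lambda>i\<in>I. w (i, e0 i)) \<partial>PiM (I \<times> UNIV) (\<lambda>_. \<mu>))"
    unfolding box_form_def by simp
  also have "(\<integral>w. f (\<lambda>i\<in>I. w (i, e0 i)) \<partial>PiM (I \<times> UNIV) (\<lambda>_. \<mu>)) = (\<integral>v. f v \<partial>PiM I (\<lambda>_. \<mu>))"
    by (rule integral_reindex_power) (use I in \<open>auto intro: inj_onI\<close>)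
  finally show ?thesis .
qed

lemma box_form_add_slot:
  assumes I: "finite I" and e0: "e0 \<in> I \<rightarrow>\<^sub>E UNIV"
    and off: "\<And>e. e \<noteq> e0 \<Longrightarrow> F e = H e" "\<And>e. e \<noteq> e0 \<Longrightarrow> G e = H e"
    and at: "\<And>v. H e0 v = F e0 v + G e0 v"
  shows "box_form I H = box_form I F + box_form I G"
proof -
  let ?C = "I \<rightarrow>\<^sub>E (UNIV :: bool set)"
  have "(\<Prod>e\<in>?C. H e (\<lambda>i\<in>I. w (i, e i)))
      = (\<Prod>e\<in>?C. F e (\<lambda>i\<in>I. w (i, e i))) + (\<Prod>e\<in>?C. G e (\<lambda>i\<in>I. w (i, e i)))" for w
  proof -
    have "(\<Prod>e\<in>?C - {e0}. U e (\<lambda>i\<in>I. w (i, e i))) = (\<Prod>e\<in>?C - {e0}. H e (\<lambda>i\<in>I. w (i, e i)))"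
      if "U = F \<or> U = G" for U
      using that off by (intro prod.cong) auto
    then show ?thesis
      using e0 I by (simp add: prod.remove[of _ e0] finite_cube at ring_distribs)
  qed
  then show ?thesis
    unfolding box_form_def using I by simp
qed

lemma box_root_const: "finite I \<Longrightarrow> i \<in> I \<Longrightarrow> 0 \<le> k \<Longrightarrow> box_root I (\<lambda>_. k) = k"
  by (simp add: box_root_def box_form_constants card_cube real_root_power_cancel)

lemma box_root_le_1:
  assumes I: "finite I" "i \<in> I"
    and f: "\<And>v. v \<in> space (PiM I (\<lambda>_. \<mu>)) \<Longrightarrow> \<bar>f v\<bar> \<le> 1"
  shows "box_root I f \<le> 1"
proof -
  have "box_form I (\<lambda>_. f) \<le> (\<integral>w. 1 \<partial>PiM (I \<times> (UNIV :: bool set)) (\<lambda>_. \<mu>))"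
    unfolding box_form_def
  proof (rule integral_power_mono)
    fix w :: "'a \<times> bool \<Rightarrow> 'o" assume w: "w \<in> space (PiM (I \<times> UNIV) (\<lambda>_. \<mu>))"
    have "\<bar>\<Prod>e\<in>I \<rightarrow>\<^sub>E (UNIV :: bool set). f (\<lambda>i\<in>I. w (i, e i))\<bar> \<le> 1"
      unfolding abs_prod using box_point_in_space[OF w] by (intro prod_le_1) (auto intro: f)
    then show "(\<Prod>e\<in>I \<rightarrow>\<^sub>E (UNIV :: bool set). f (\<lambda>i\<in>I. w (i, e i))) \<le> 1" by linarith
  qed (use I in auto)
  then have "box_root I f ^ 2 ^ card I \<le> 1 ^ 2 ^ card I"
    using I by (simp add: box_root_power)
  then show ?thesis
    by (rule power_le_imp_le_base[where n="2 ^ card I - 1", simplified]) simp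
qed

lemma abs_integral_le_box_root:
  assumes I: "finite I" "i \<in> I"
  shows "\<bar>\<integral>v. f v \<partial>PiM I (\<lambda>_. \<mu>)\<bar> \<le> box_root I f"
proof -
  let ?C = "I \<rightarrow>\<^sub>E (UNIV :: bool set)"
  define e0 where "e0 = (\<lambda>i\<in>I. False)"
  have e0: "e0 \<in> ?C" by (simp add: e0_def)
  have "\<bar>\<integral>v. f v \<partial>PiM I (\<lambda>_. \<mu>)\<bar> = \<bar>box_form I (\<lambda>e. if e = e0 then f else (\<lambda>_. 1))\<bar>"
    by (subst box_form_one_slot[OF I(1) e0]) simp
  also have "\<dots> \<le> (\<Prod>e\<in>?C. box_root I (if e = e0 then f else (\<lambda>_. 1)))"
    by (rule gowers_cauchy_schwarz[OF I])
  also have "\<dots> = box_root I f"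
    using e0 I by (simp add: prod.remove[of _ e0] finite_cube box_root_const[OF I])
  finally show ?thesis .
qed

text \<open>The triangle inequality: the power of the norm of a sum expands into box forms with
independently chosen summands at the vertices, and Gowers--Cauchy--Schwarz bounds these by
the terms of the expanded power of the sum of norms.\<close>

lemma box_root_sum_le:
  assumes I: "finite I" "i \<in> I" and S: "finite S"
  shows "box_root I (\<lambda>v. \<Sum>a\<in>S. u a v) \<le> (\<Sum>a\<in>S. box_root I (u a))"
proof -
  let ?C = "I \<rightarrow>\<^sub>E (UNIV :: bool set)"
  have "box_form I (\<lambda>_ v. \<Sum>a\<in>S. u a v) = (\<Sum>\<sigma>\<in>?C \<rightarrow>\<^sub>E S. box_form I (\<lambda>e. u (\<sigma> e)))"
    unfolding box_form_def
    by (subst prod_sum_PiE) (use I S in \<open>auto simp: finite_cube\<close>)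
  also have "\<dots> \<le> (\<Sum>\<sigma>\<in>?C \<rightarrow>\<^sub>E S. \<Prod>e\<in>?C. box_root I (u (\<sigma> e)))"
    using gowers_cauchy_schwarz[OF I] by (intro sum_mono) (meson abs_le_D1)
  also have "\<dots> = (\<Prod>e\<in>?C. \<Sum>a\<in>S. box_root I (u a))"
    by (subst prod_sum_PiE) (use I S in \<open>auto simp: finite_cube\<close>)
  also have "\<dots> = (\<Sum>a\<in>S. box_root I (u a)) ^ 2 ^ card I"
    using I by (simp add: card_cube)
  finally have "box_root I (\<lambda>v. \<Sum>a\<in>S. u a v) ^ 2 ^ card I \<le> (\<Sum>a\<in>S. box_root I (u a)) ^ 2 ^ card I"
    using I by (simp add: box_root_power)
  then show ?thesis
    by (rule power_le_imp_le_base[where n="2 ^ card I - 1", simplified])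
      (intro sum_nonneg box_root_nonneg[OF I])
qed

lemma box_root_uminus:
  assumes I: "finite I" "i \<in> I"
  shows "box_root I (\<lambda>v. - u v) = box_root I u"
proof -
  have "card I \<noteq> 0" using I by auto
  then have "even (card (I \<rightarrow>\<^sub>E (UNIV :: bool set)))"
    using I by (simp add: card_cube card_gt_0_iff)
  then show ?thesis
    by (simp add: box_root_def box_form_def prod_uminus)
qed

section \<open>Box counts of functions close to their mean\<close>

text \<open>Replace the function by its mean one vertex at a time. Each replacement costs a box form with
\<open>f - c\<close> at one vertex and functions bounded by \<open>1\<close> elsewhere, hence at most the box norm of
\<open>f - c\<close>. At the last vertex all other functions are constant and the cost is a multiple of
the integral of \<open>f - c\<close>, that is, zero; this is the \<open>- 1\<close> in the bound.\<close>

lemma box_form_near_mean_power: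
  assumes I: "finite I" "i \<in> I"
    and f: "\<And>v. v \<in> space (PiM I (\<lambda>_. \<mu>)) \<Longrightarrow> 0 \<le> f v \<and> f v \<le> 1"
    and c: "c = (\<integral>v. f v \<partial>PiM I (\<lambda>_. \<mu>))"
  shows "\<bar>box_form I (\<lambda>_. f) - c ^ 2 ^ card I\<bar> \<le> (2 ^ card I - 1) * box_root I (\<lambda>v. f v - c)"
proof -
  let ?C = "I \<rightarrow>\<^sub>E (UNIV :: bool set)" and ?g = "box_root I (\<lambda>v. f v - c)"
  have c01: "0 \<le> c" "c \<le> 1"
    using integral_power_mono[of I "\<lambda>_. 0" f] integral_power_mono[of I f "\<lambda>_. 1"] f I by (auto simp: c)
  have hybrid: "\<bar>box_form I (\<lambda>e. if e \<in> T then f else (\<lambda>_. c)) - c ^ 2 ^ card I\<bar> \<le> (real (card T) - 1) * ?g"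
    if "finite T" "T \<noteq> {}" "T \<subseteq> ?C" for T
    using that
  proof (induction T rule: finite_ne_induct)
    case (singleton e0)
    have "box_form I (\<lambda>e. if e \<in> {e0} then f else (\<lambda>_. c)) = c ^ (2 ^ card I - 1) * c"
      using box_form_one_slot[of I e0 f c] I singleton by (simp add: c)
    also have "\<dots> = c ^ 2 ^ card I"
      by (rule power_minus_mult) simp
    finally show ?case by simp
  next
    case (insert e0 T)
    let ?D = "\<lambda>e. if e = e0 then (\<lambda>v. f v - c) else if e \<in> T then f else (\<lambda>_. c)"
    have "box_form I (\<lambda>e. if e \<in> insert e0 T then f else (\<lambda>_. c))
        = box_form I (\<lambda>e. if e \<in> T then f else (\<lambda>_. c)) + box_form I ?D"
      using insert.hyps insert.prems I by (intro box_form_add_slot[of I e0]) auto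
    moreover have "\<bar>box_form I ?D\<bar> \<le> ?g"
    proof -
      have "\<bar>box_form I ?D\<bar> \<le> (\<Prod>e\<in>?C. box_root I (?D e))"
        by (rule gowers_cauchy_schwarz[OF I])
      also have "\<dots> = ?g * (\<Prod>e\<in>?C - {e0}. box_root I (?D e))"
        using insert.prems I by (simp add: prod.remove[of _ e0] finite_cube)
      also have "\<dots> \<le> ?g * 1"
        using f c01 by (intro mult_left_mono prod_le_1 box_root_nonneg[OF I] conjI box_root_le_1[OF I]) auto
      finally show ?thesis by simp
    qed
    ultimately show ?case
      using insert.IH insert.prems insert.hyps by (simp add: algebra_simps)
  qed
  have "box_form I (\<lambda>e. if e \<in> ?C then f else (\<lambda>_. c)) = box_form I (\<lambda>_. f)"
    by (rule box_form_cong) simp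
  moreover have "?C \<noteq> {}" by (simp add: PiE_eq_empty_iff)
  ultimately show ?thesis
    using hybrid[of ?C] I by (simp add: card_cube finite_cube)
qed

definition subbox_count :: "'i set \<Rightarrow> (('i \<Rightarrow> 'o) \<Rightarrow> real) \<Rightarrow> ('i \<Rightarrow> bool) set \<Rightarrow> real" where
  "subbox_count I f T = box_form I (\<lambda>e. if e \<in> T then f else (\<lambda>_. 1))"

lemma subbox_count_le:
  assumes I: "finite I" "i \<in> I" and T: "T \<subseteq> I \<rightarrow>\<^sub>E UNIV"
  shows "subbox_count I f T \<le> box_root I f ^ card T"
proof -
  let ?C = "I \<rightarrow>\<^sub>E (UNIV :: bool set)"
  have "subbox_count I f T \<le> (\<Prod>e\<in>?C. box_root I (if e \<in> T then f else (\<lambda>_. 1)))"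
    unfolding subbox_count_def by (rule abs_le_D1[OF gowers_cauchy_schwarz[OF I]])
  also have "\<dots> = (\<Prod>e\<in>?C. if e \<in> T then box_root I f else 1)"
    by (intro prod.cong) (auto simp: box_root_const[OF I])
  also have "\<dots> = box_root I f ^ card T"
    using T I by (simp add: prod.If_cases finite_cube Int_absorb1)
  finally show ?thesis .
qed

text \<open>A second moment that hardly exceeds the square of the mean forces a function to be nearly
constant in \<open>L\<^sup>2\<close>, and two nearly constant functions are nearly uncorrelated. Bounding the
covariance by the two variances, not by their square roots, keeps the loss linear.\<close>

lemma integral_product_near:
  fixes A B :: "('k \<Rightarrow> 'o) \<Rightarrow> real"
  assumes K: "finite K"
    and AA: "(\<integral>w. A w * A w \<partial>PiM K (\<lambda>_. \<mu>)) \<le> a * a + \<eta>"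
    and BB: "(\<integral>w. B w * B w \<partial>PiM K (\<lambda>_. \<mu>)) \<le> b * b + \<eta>"
    and A: "\<bar>(\<integral>w. A w \<partial>PiM K (\<lambda>_. \<mu>)) - a\<bar> \<le> \<zeta>"
    and B: "\<bar>(\<integral>w. B w \<partial>PiM K (\<lambda>_. \<mu>)) - b\<bar> \<le> \<zeta>"
    and ab: "0 \<le> a" "a \<le> 1" "0 \<le> b" "b \<le> 1"
  shows "\<bar>(\<integral>w. A w * B w \<partial>PiM K (\<lambda>_. \<mu>)) - a * b\<bar> \<le> \<eta> + 4 * \<zeta>"
proof -
  let ?E = "\<lambda>u :: ('k \<Rightarrow> 'o) \<Rightarrow> real. \<integral>w. u w \<partial>PiM K (\<lambda>_. \<mu>)"
  have var: "?E (\<lambda>w. (U w - u)\<^sup>2) \<le> \<eta> + 2 * \<zeta>"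
    if U: "?E (\<lambda>w. U w * U w) \<le> u * u + \<eta>" "\<bar>?E U - u\<bar> \<le> \<zeta>" "0 \<le> u" "u \<le> 1" for U u
  proof -
    have "?E (\<lambda>w. (U w - u)\<^sup>2) = ?E (\<lambda>w. U w * U w - 2 * u * U w + u * u)"
      by (intro Bochner_Integration.integral_cong) (auto simp: power2_eq_square algebra_simps)
    also have "\<dots> = ?E (\<lambda>w. U w * U w) - 2 * u * ?E U + u * u"
      using K by simp
    also have "\<dots> \<le> \<eta> + 2 * (u * (u - ?E U))"
      using U by (simp add: algebra_simps)
    also have "u * (u - ?E U) \<le> 1 * \<zeta>"
    proof -
      have "u * (u - ?E U) \<le> \<bar>u\<bar> * \<bar>u - ?E U\<bar>" by (metis abs_ge_self abs_mult)
      also have "\<dots> \<le> 1 * \<zeta>" using U by (intro mult_mono) (auto simp: abs_minus_commute)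
      finally show ?thesis .
    qed
    finally show ?thesis by simp
  qed
  have cov: "\<bar>?E (\<lambda>w. (A w - a) * (B w - b))\<bar> \<le> \<eta> + 2 * \<zeta>"
  proof -
    have "\<bar>?E (\<lambda>w. (A w - a) * (B w - b))\<bar> \<le> ?E (\<lambda>w. ((A w - a)\<^sup>2 + (B w - b)\<^sup>2) / 2)"
    proof (rule order_trans[OF integral_abs_bound integral_power_mono[OF K]])
      fix w
      have "2 * (\<bar>A w - a\<bar> * \<bar>B w - b\<bar>) \<le> \<bar>A w - a\<bar>\<^sup>2 + \<bar>B w - b\<bar>\<^sup>2"
        using sum_squares_bound[of "\<bar>A w - a\<bar>" "\<bar>B w - b\<bar>"] by simp
      then show "\<bar>(A w - a) * (B w - b)\<bar> \<le> ((A w - a)\<^sup>2 + (B w - b)\<^sup>2) / 2"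
        by (simp add: abs_mult)
    qed
    also have "\<dots> = (?E (\<lambda>w. (A w - a)\<^sup>2) + ?E (\<lambda>w. (B w - b)\<^sup>2)) / 2"
      using K by simp
    finally show ?thesis
      using var[OF AA A ab(1,2)] var[OF BB B ab(3,4)] by simp
  qed
  have "?E (\<lambda>w. (A w - a) * (B w - b)) = ?E (\<lambda>w. A w * B w - b * A w - a * B w + a * b)"
    by (intro Bochner_Integration.integral_cong) (auto simp: algebra_simps)
  also have "\<dots> = ?E (\<lambda>w. A w * B w) - b * ?E A - a * ?E B + a * b"
    using K by simp
  finally have "?E (\<lambda>w. A w * B w) - a * b
      = ?E (\<lambda>w. (A w - a) * (B w - b)) + b * (?E A - a) + a * (?E B - b)"
    by (simp add: algebra_simps)
  moreover have "\<bar>b * (?E A - a)\<bar> \<le> 1 * \<zeta>" "\<bar>a * (?E B - b)\<bar> \<le> 1 * \<zeta>"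
    unfolding abs_mult by (intro mult_mono A B; use ab in auto)+
  ultimately show ?thesis
    using cov by linarith
qed

text \<open>If no sub-box count exceeds its expected value by more than \<open>\<eta>\<close>, then none falls far below it
either. Sets of vertices are built up one direction of the cube at a time: splitting along
\<open>i\<close> writes the count of \<open>T\<close> as the integral of a product of two facet means. Their means are
counts with one direction less, known by induction, and their second moments are counts of a
facet of \<open>T\<close> together with its mirror image, bounded by assumption. So both facet means are
nearly constant. The expected value is written as a product over the cube because in this
form it splits along \<open>i\<close> in the same way as the count.\<close>

lemma subbox_count_near:
  assumes I: "finite I" "i0 \<in> I"
    and c: "c = (\<integral>v. f v \<partial>PiM I (\<lambda>_. \<mu>))" "0 \<le> c" "c \<le> 1"
    and upper: "\<And>T. T \<subseteq> I \<rightarrow>\<^sub>E UNIV \<Longrightarrow>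
      subbox_count I f T \<le> (\<Prod>e\<in>I \<rightarrow>\<^sub>E UNIV. if e \<in> T then c else 1) + \<eta>"
    and \<eta>: "0 \<le> \<eta>"
    and K: "K \<subseteq> I" and T: "T \<subseteq> {e \<in> I \<rightarrow>\<^sub>E UNIV. \<forall>k\<in>I - K. \<not> e k}"
  shows "\<bar>subbox_count I f T - (\<Prod>e\<in>I \<rightarrow>\<^sub>E UNIV. if e \<in> T then c else 1)\<bar> \<le> (4 ^ card K - 1) * \<eta>"
  using finite_subset[OF K I(1)] K T
proof (induction K arbitrary: T rule: finite_induct)
  case empty
  define e0 where "e0 = (\<lambda>i\<in>I. False)"
  have e0: "e0 \<in> I \<rightarrow>\<^sub>E UNIV" by (simp add: e0_def)
  have "T \<subseteq> {e0}"
    using empty.prems by (auto simp: e0_def PiE_iff extensional_def fun_eq_iff)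
  then consider "T = {}" | "T = {e0}" by auto
  then show ?case
  proof cases
    case 1
    then show ?thesis using I by (simp add: subbox_count_def box_form_constants)
  next
    case 2
    have "subbox_count I f T = c"
      using box_form_one_slot[OF I(1) e0, of f 1] 2 by (simp add: subbox_count_def c)
    then show ?thesis
      using 2 e0 I by (simp add: prod.remove[of _ e0] finite_cube)
  qed
next
  case (insert i K)
  let ?C = "I \<rightarrow>\<^sub>E (UNIV :: bool set)" and ?C' = "(I - {i}) \<rightarrow>\<^sub>E (UNIV :: bool set)"
  let ?R = "(I - {i}) \<times> (UNIV :: bool set)"
  let ?F = "\<lambda>e. if e \<in> T then f else (\<lambda>_. 1)"
  let ?A = "\<lambda>b. face_mean I i (\<lambda>e. ?F (e(i := b)))"
  let ?W = "\<lambda>T. \<Prod>e\<in>?C. if e \<in> T then c else 1"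
  define p where "p b = (\<Prod>e\<in>?C'. if e(i := b) \<in> T then c else 1)" for b
  have i: "i \<in> I" using insert.prems by auto
  have p01: "0 \<le> p b" "p b \<le> 1" for b
    unfolding p_def using c(2,3) by (intro prod_nonneg prod_le_1; simp)+
  have upd_C: "e(i := b) \<in> ?C" if "e \<in> ?C'" for e b
    using PiE_fun_upd[of b "\<lambda>_. UNIV" i e "I - {i}"] that i by (simp add: insert_absorb)
  have square: "(\<integral>w. ?A b w * ?A b w \<partial>PiM ?R (\<lambda>_. \<mu>)) \<le> p b * p b + \<eta>" for b
  proof -
    \<comment> \<open>The facet of \<open>T\<close> where \<open>e i = b\<close>, doubled in direction \<open>i\<close>.\<close>
    let ?T = "{e \<in> ?C. e(i := b) \<in> T}"
    have "(\<integral>w. ?A b w * ?A b w \<partial>PiM ?R (\<lambda>_. \<mu>)) = box_form I (\<lambda>e. ?F (e(i := b)))"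
      by (rule box_form_face_eq_square[OF I(1) i, symmetric])
    also have "\<dots> = subbox_count I f ?T"
      unfolding subbox_count_def by (rule box_form_cong) simp
    also have "\<dots> \<le> ?W ?T + \<eta>"
      by (rule upper) auto
    also have "?W ?T = p b * p b"
      unfolding prod_funcset_insert[OF I(1) i] p_def
      by (intro arg_cong2[where f="(*)"] prod.cong refl) (simp_all add: upd_C)
    finally show ?thesis .
  qed
  have mean: "\<bar>(\<integral>w. ?A b w \<partial>PiM ?R (\<lambda>_. \<mu>)) - p b\<bar> \<le> (4 ^ card K - 1) * \<eta>" for b
  proof -
    \<comment> \<open>The facet of \<open>T\<close> where \<open>e i = b\<close>, moved to \<open>e i = False\<close>, as the induction hypothesis demands.\<close>
    let ?T = "{e \<in> ?C. \<not> e i \<and> e(i := b) \<in> T}"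
    have one: "face_mean I i (\<lambda>e _. 1) w = 1" for w
      by (simp add: face_mean_def prob_space)
    have "subbox_count I f ?T = box_form I (\<lambda>e. if e i then (\<lambda>_. 1) else ?F (e(i := b)))"
      unfolding subbox_count_def by (rule box_form_cong) simp
    also have "\<dots> = (\<integral>w. ?A b w \<partial>PiM ?R (\<lambda>_. \<mu>))"
      by (subst box_form_split[OF I(1) i]) (simp add: one)
    finally have "(\<integral>w. ?A b w \<partial>PiM ?R (\<lambda>_. \<mu>)) = subbox_count I f ?T" by simp
    moreover have "?W ?T = p b * 1"
      unfolding prod_funcset_insert[OF I(1) i] p_def
      by (intro arg_cong2[where f="(*)"] prod.cong refl prod.neutral ballI) (simp_all add: upd_C)
    moreover have "?T \<subseteq> {e \<in> ?C. \<forall>k\<in>I - K. \<not> e k}"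
    proof safe
      fix e k assume e: "\<not> e i" "e(i := b) \<in> T" "k \<in> I" "k \<notin> K" "e k"
      then have "k \<noteq> i" by auto
      then show False using e insert.prems(2) by (auto dest!: subsetD)
    qed
    ultimately show ?thesis
      using insert.IH[of ?T] insert.prems by simp
  qed
  have "subbox_count I f T = (\<integral>w. ?A False w * ?A True w \<partial>PiM ?R (\<lambda>_. \<mu>))"
    unfolding subbox_count_def by (rule box_form_split[OF I(1) i])
  moreover have "?W T = p False * p True"
    unfolding prod_funcset_insert[OF I(1) i] p_def ..
  ultimately have "\<bar>subbox_count I f T - ?W T\<bar> \<le> \<eta> + 4 * ((4 ^ card K - 1) * \<eta>)"
    using integral_product_near[OF _ square[of False] square[of True] mean mean p01 p01] I by simp
  also have "\<dots> \<le> (4 ^ card (insert i K) - 1) * \<eta>"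
    using insert.hyps \<eta> by (simp add: algebra_simps)
  finally show ?case .
qed

text \<open>A converse of \<open>box_form_near_mean_power\<close>. By Gowers--Cauchy--Schwarz a sub-box count is at most
a power of the box norm of \<open>f\<close>, so an upper bound on this norm controls all sub-box counts
from above, hence from both sides. Expanding the box form of \<open>f - c\<close> over the \<open>2 ^ 2 ^ card I\<close>
sets of vertices where \<open>f\<close> is chosen, the main terms are those of \<open>(c - c) ^ 2 ^ card I\<close> and
cancel.\<close>

lemma box_form_centred_le:
  assumes I: "finite I" "i \<in> I"
    and f: "\<And>v. v \<in> space (PiM I (\<lambda>_. \<mu>)) \<Longrightarrow> 0 \<le> f v \<and> f v \<le> 1"
    and c: "c = (\<integral>v. f v \<partial>PiM I (\<lambda>_. \<mu>))"
    and y: "0 \<le> y" and near: "box_root I f \<le> c + y"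
  shows "box_form I (\<lambda>_ v. f v - c) \<le> 2 ^ 2 ^ card I * (4 ^ card I * (2 ^ card I * y))"
proof -
  let ?C = "I \<rightarrow>\<^sub>E (UNIV :: bool set)" and ?N = "2 ^ card I :: nat"
  have c01: "0 \<le> c" "c \<le> 1"
    using integral_power_mono[of I "\<lambda>_. 0" f] integral_power_mono[of I f "\<lambda>_. 1"] f I by (auto simp: c)
  have W: "(\<Prod>e\<in>?C. if e \<in> T then c else 1) = c ^ card T" if "T \<subseteq> ?C" for T
    using that I by (simp add: prod.If_cases finite_cube Int_absorb1)
  have upper: "subbox_count I f T \<le> c ^ card T + ?N * y" if T: "T \<subseteq> ?C" for T
  proof -
    \<comment> \<open>Capping at \<open>1\<close> makes powers Lipschitz with constant the exponent.\<close>
    define z where "z = min 1 (c + y)"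
    have z: "c \<le> z" "z \<le> 1" "z - c \<le> y" "box_root I f \<le> z"
      using c01 y near box_root_le_1[OF I, of f] f by (auto simp: z_def)
    have "card T \<le> ?N"
      using card_mono[OF _ T] I by (simp add: finite_cube card_cube)
    then have cardT: "real (card T) \<le> 2 ^ card I"
      by (metis of_nat_le_iff of_nat_numeral of_nat_power)
    have "subbox_count I f T \<le> box_root I f ^ card T"
      by (rule subbox_count_le[OF I T])
    also have "\<dots> \<le> z ^ card T"
      using z by (intro power_mono box_root_nonneg[OF I])
    also have "\<dots> \<le> c ^ card T + card T * (z - c)"
      using norm_power_diff[of z c "card T"] z c01 by (simp add: abs_le_iff)
    also have "\<dots> \<le> c ^ card T + ?N * y"
      using z cardT y by (intro add_left_mono mult_mono) auto
    finally show ?thesis .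
  qed
  have all_near: "\<bar>subbox_count I f T - c ^ card T\<bar> \<le> 4 ^ card I * (?N * y)" if T: "T \<subseteq> ?C" for T
  proof -
    have "\<bar>subbox_count I f T - c ^ card T\<bar> \<le> (4 ^ card I - 1) * (?N * y)"
      using subbox_count_near[OF I c c01, of "?N * y" I T] upper T y by (simp add: W)
    also have "\<dots> \<le> 4 ^ card I * (?N * y)"
      using y by (intro mult_right_mono) auto
    finally show ?thesis .
  qed
  have expand: "(\<Prod>e\<in>?C. f (\<lambda>i\<in>I. w (i, e i)) - c)
      = (\<Sum>T\<in>Pow ?C. (- c) ^ card (?C - T) * (\<Prod>e\<in>?C. (if e \<in> T then f else (\<lambda>_. 1)) (\<lambda>i\<in>I. w (i, e i))))" for w
  proof -
    have "(\<Prod>e\<in>?C. f (\<lambda>i\<in>I. w (i, e i)) + - c)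
        = (\<Sum>T\<in>Pow ?C. (\<Prod>e\<in>T. f (\<lambda>i\<in>I. w (i, e i))) * (\<Prod>e\<in>?C - T. - c))"
      by (rule prod_add) (use I in \<open>simp add: finite_cube\<close>)
    also have "\<dots> = (\<Sum>T\<in>Pow ?C. (- c) ^ card (?C - T) * (\<Prod>e\<in>?C. (if e \<in> T then f else (\<lambda>_. 1)) (\<lambda>i\<in>I. w (i, e i))))"
    proof (rule sum.cong[OF refl])
      fix T assume "T \<in> Pow ?C"
      then have T: "T \<subseteq> ?C" by simp
      have "(\<Prod>e\<in>?C. (if e \<in> T then f else (\<lambda>_. 1)) (\<lambda>i\<in>I. w (i, e i)))
          = (\<Prod>e\<in>?C. if e \<in> T then f (\<lambda>i\<in>I. w (i, e i)) else 1)"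
        by (rule prod.cong) auto
      also have "\<dots> = (\<Prod>e\<in>T. f (\<lambda>i\<in>I. w (i, e i)))"
        using T I by (simp add: prod.If_cases finite_cube Int_absorb1)
      finally show "(\<Prod>e\<in>T. f (\<lambda>i\<in>I. w (i, e i))) * (\<Prod>e\<in>?C - T. - c)
          = (- c) ^ card (?C - T) * (\<Prod>e\<in>?C. (if e \<in> T then f else (\<lambda>_. 1)) (\<lambda>i\<in>I. w (i, e i)))"
        by simp
    qed
    finally show ?thesis by simp
  qed
  have "box_form I (\<lambda>_ v. f v - c) = (\<Sum>T\<in>Pow ?C. (- c) ^ card (?C - T) * subbox_count I f T)"
    unfolding box_form_def subbox_count_def expand using I by simp
  moreover have "0 = (\<Sum>T\<in>Pow ?C. (- c) ^ card (?C - T) * c ^ card T)"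
  proof -
    have "0 = (\<Prod>e\<in>?C. c + - c)"
      using I by (simp add: card_cube)
    also have "\<dots> = (\<Sum>T\<in>Pow ?C. (\<Prod>e\<in>T. c) * (\<Prod>e\<in>?C - T. - c))"
      by (rule prod_add) (use I in \<open>simp add: finite_cube\<close>)
    finally show ?thesis by (simp add: mult.commute)
  qed
  ultimately have "box_form I (\<lambda>_ v. f v - c)
      = (\<Sum>T\<in>Pow ?C. (- c) ^ card (?C - T) * (subbox_count I f T - c ^ card T))"
    by (simp add: right_diff_distrib sum_subtractf)
  also have "\<dots> \<le> (\<Sum>T\<in>Pow ?C. 4 ^ card I * (?N * y))"
  proof (rule sum_mono)
    fix T assume T: "T \<in> Pow ?C"
    have "\<bar>(- c) ^ card (?C - T) * (subbox_count I f T - c ^ card T)\<bar> \<le> 1 * (4 ^ card I * (?N * y))"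
      unfolding abs_mult using c01 T
      by (intro mult_mono all_near) (auto simp: power_abs power_le_one)
    then show "(- c) ^ card (?C - T) * (subbox_count I f T - c ^ card T) \<le> 4 ^ card I * (?N * y)"
      by linarith
  qed
  also have "\<dots> = 2 ^ 2 ^ card I * (4 ^ card I * (2 ^ card I * y))"
    using I by (simp add: card_Pow finite_cube card_cube)
  finally show ?thesis .
qed

end

section \<open>Two inequalities for weighted averages\<close>

text \<open>A quantitative form of convexity. The gap between \<open>x ^ n\<close> and its tangent at \<open>c\<close> obeys the
recursion \<open>gap\<^sub>n\<^sub>+\<^sub>1 = x * gap\<^sub>n + n * c ^ (n - 1) * (x - c)\<^sup>2\<close>; the first summand carries the induction
for \<open>x \<ge> c\<close>, and for \<open>x < c\<close> the second one makes up for the missing factor.\<close>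

lemma power_tangent_gap:
  fixes x c :: real
  assumes "0 \<le> x" and "0 \<le> c" and "2 \<le> n"
  shows "\<bar>x - c\<bar> ^ n \<le> x ^ n - c ^ n - real n * c ^ (n - 1) * (x - c)"
  using assms(3)
proof (induction n rule: dec_induct)
  case base
  show ?case by (simp add: power2_eq_square algebra_simps)
next
  case (step n)
  define gap where "gap = x ^ n - c ^ n - real n * c ^ (n - 1) * (x - c)"
  have gap: "\<bar>x - c\<bar> ^ n \<le> gap" using step.IH by (simp add: gap_def)
  obtain k where k: "n = Suc (Suc k)"
    using le_Suc_ex[OF step.hyps(1)] by auto
  have n: "c ^ n = c * c ^ (n - 1)" "c ^ (n - 1) = c * c ^ (n - 2)"
    by (simp_all add: k)
  have rec: "x ^ Suc n - c ^ Suc n - real (Suc n) * c ^ (Suc n - 1) * (x - c)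
      = x * gap + real n * c ^ (n - 1) * (x - c)\<^sup>2"
    unfolding gap_def by (simp add: n(1) power2_eq_square algebra_simps)
  have sq: "c * \<bar>x - c\<bar> ^ n \<le> c ^ (n - 1) * (x - c)\<^sup>2" if "x < c"
  proof -
    have "\<bar>x - c\<bar> ^ (n - 2) \<le> c ^ (n - 2)"
      using that assms by (intro power_mono) auto
    then have "c * (\<bar>x - c\<bar> ^ (n - 2) * \<bar>x - c\<bar>\<^sup>2) \<le> c * (c ^ (n - 2) * \<bar>x - c\<bar>\<^sup>2)"
      using assms by (intro mult_left_mono mult_right_mono) auto
    moreover have "\<bar>x - c\<bar> ^ (n - 2) * \<bar>x - c\<bar>\<^sup>2 = \<bar>x - c\<bar> ^ n"
      unfolding k by (simp add: power2_eq_square)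
    ultimately show ?thesis unfolding n(2) by (simp add: mult.assoc)
  qed
  have "\<bar>x - c\<bar> ^ Suc n \<le> x * \<bar>x - c\<bar> ^ n + c ^ (n - 1) * (x - c)\<^sup>2"
  proof (cases "x < c")
    case True
    have "\<bar>x - c\<bar> * \<bar>x - c\<bar> ^ n \<le> c * \<bar>x - c\<bar> ^ n"
      using True assms by (intro mult_right_mono) auto
    also have "\<dots> \<le> c ^ (n - 1) * (x - c)\<^sup>2" by (rule sq[OF True])
    finally show ?thesis using assms by (simp add: add_increasing)
  next
    case False
    have "\<bar>x - c\<bar> * \<bar>x - c\<bar> ^ n \<le> x * \<bar>x - c\<bar> ^ n"
      using False assms by (intro mult_right_mono) auto
    then show ?thesis using assms by (simp add: add_increasing2)
  qed
  also have "\<dots> \<le> x * gap + real n * c ^ (n - 1) * (x - c)\<^sup>2"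
  proof (rule add_mono)
    show "x * \<bar>x - c\<bar> ^ n \<le> x * gap" using gap assms by (intro mult_left_mono)
    have "1 * (c ^ (n - 1) * (x - c)\<^sup>2) \<le> real n * (c ^ (n - 1) * (x - c)\<^sup>2)"
      using step.hyps assms by (intro mult_right_mono) auto
    then show "c ^ (n - 1) * (x - c)\<^sup>2 \<le> real n * c ^ (n - 1) * (x - c)\<^sup>2"
      by (simp add: mult.assoc)
  qed
  finally show ?case unfolding rec .
qed

text \<open>Equality in Jensen's inequality forces a distribution to be concentrated at its mean. Here the
defect of \<open>j\<close> is measured against the tangent of the power function at the mean, so that the
linear terms average out; the defect dominates both \<open>\<bar>c j - m\<bar> ^ n\<close> and \<open>b j - c j ^ n\<close>, and
Markov's inequality applied to it bounds both kinds of exceptions at once.\<close>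

lemma concentration_of_power_means:
  fixes lam b c :: "'j \<Rightarrow> real"
  assumes J: "finite J" and lam: "\<And>j. j \<in> J \<Longrightarrow> 0 \<le> lam j" "(\<Sum>j\<in>J. lam j) = 1"
    and c: "\<And>j. j \<in> J \<Longrightarrow> 0 \<le> c j" and b: "\<And>j. j \<in> J \<Longrightarrow> c j ^ n \<le> b j"
    and n: "2 \<le> n" and y: "0 < y"
    and m: "m = (\<Sum>j\<in>J. lam j * c j)"
    and sum_b: "(\<Sum>j\<in>J. lam j * b j) \<le> m ^ n + \<tau>"
  shows "(\<Sum>j | j \<in> J \<and> \<not> (\<bar>c j - m\<bar> \<le> y \<and> b j \<le> c j ^ n + y ^ n). lam j) \<le> \<tau> / y ^ n"
proof -
  define q where "q j = b j - m ^ n - real n * m ^ (n - 1) * (c j - m)" for j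
  let ?Bad = "{j \<in> J. \<not> (\<bar>c j - m\<bar> \<le> y \<and> b j \<le> c j ^ n + y ^ n)}"
  have m0: "0 \<le> m" unfolding m by (intro sum_nonneg mult_nonneg_nonneg lam c)
  have q: "\<bar>c j - m\<bar> ^ n + (b j - c j ^ n) \<le> q j" if "j \<in> J" for j
    using power_tangent_gap[OF c[OF that] m0 n] by (simp add: q_def)
  have q0: "0 \<le> q j" if "j \<in> J" for j
    using q[OF that] b[OF that] zero_le_power_abs[of "c j - m" n] by linarith
  have bad: "y ^ n \<le> q j" if "j \<in> ?Bad" for j
  proof (cases "\<bar>c j - m\<bar> \<le> y")
    case True
    then have "c j ^ n + y ^ n < b j" "j \<in> J" using that by auto
    then show ?thesis using q[of j] zero_le_power_abs[of "c j - m" n] by linarith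
  next
    case False
    then have "y ^ n \<le> \<bar>c j - m\<bar> ^ n" using y by (intro power_mono) auto
    then show ?thesis using that q[of j] b[of j] by auto
  qed
  have "y ^ n * (\<Sum>j\<in>?Bad. lam j) = (\<Sum>j\<in>?Bad. lam j * y ^ n)"
    by (simp add: sum_distrib_left mult.commute)
  also have "\<dots> \<le> (\<Sum>j\<in>?Bad. lam j * q j)"
    using lam(1) bad by (intro sum_mono mult_left_mono) auto
  also have "\<dots> \<le> (\<Sum>j\<in>J. lam j * q j)"
    using J lam(1) q0 by (intro sum_mono2) auto
  also have "\<dots> = (\<Sum>j\<in>J. lam j * b j - m ^ n * lam j
      - real n * m ^ (n - 1) * (lam j * c j) + real n * m ^ (n - 1) * m * lam j)"
    by (intro sum.cong) (auto simp: q_def algebra_simps)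
  also have "\<dots> = (\<Sum>j\<in>J. lam j * b j) - m ^ n"
    by (simp add: sum.distrib sum_subtractf lam(2) flip: sum_distrib_left m)
  also have "\<dots> \<le> \<tau>" using sum_b by simp
  finally show ?thesis using y by (simp add: pos_le_divide_eq mult.commute)
qed

lemma weighted_average_abs_le:
  fixes lam u :: "'j \<Rightarrow> real"
  assumes J: "finite J" and lam: "\<And>j. j \<in> J \<Longrightarrow> 0 \<le> lam j" "(\<Sum>j\<in>J. lam j) = 1"
    and G: "G \<subseteq> J" "1 - r \<le> (\<Sum>j\<in>G. lam j)"
    and u: "\<And>j. j \<in> G \<Longrightarrow> \<bar>u j\<bar> \<le> A" "\<And>j. j \<in> J \<Longrightarrow> \<bar>u j\<bar> \<le> 1" and A: "0 \<le> A"
  shows "\<bar>\<Sum>j\<in>J. lam j * u j\<bar> \<le> A + r"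
proof -
  have split: "sum g J = sum g G + sum g (J - G)" for g :: "'j \<Rightarrow> real"
    using sum.subset_diff[OF G(1) J, of g] by simp
  have "\<bar>\<Sum>j\<in>J. lam j * u j\<bar> \<le> (\<Sum>j\<in>J. lam j * \<bar>u j\<bar>)"
    using lam(1) by (intro order_trans[OF sum_abs] sum_mono) (simp add: abs_mult)
  also have "\<dots> \<le> (\<Sum>j\<in>G. lam j * A) + (\<Sum>j\<in>J - G. lam j * 1)"
    unfolding split using lam(1) u G(1) by (intro add_mono sum_mono mult_left_mono) auto
  also have "\<dots> = A * (\<Sum>j\<in>G. lam j) + (1 - (\<Sum>j\<in>G. lam j))"
    using split[of lam] lam(2) by (simp add: sum_distrib_left mult.commute)
  also have "\<dots> \<le> A * 1 + r"
    using G(2) A lam(1) split[of lam] lam(2) sum_nonneg[of "J - G" lam]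
    by (intro add_mono mult_left_mono) auto
  finally show ?thesis by simp
qed

lemma sum_UN_le:
  fixes f :: "'b \<Rightarrow> real"
  assumes "finite S" and "\<And>a. a \<in> S \<Longrightarrow> finite (A a)" and "\<And>a x. a \<in> S \<Longrightarrow> x \<in> A a \<Longrightarrow> 0 \<le> f x"
  shows "sum f (\<Union>a\<in>S. A a) \<le> (\<Sum>a\<in>S. sum f (A a))"
  using assms
proof (induction S rule: finite_induct)
  case empty
  then show ?case by simp
next
  case (insert a S)
  have "0 \<le> sum f (A a \<inter> (\<Union>a\<in>S. A a))"
    using insert.prems(2)[of a] by (intro sum_nonneg) auto
  then have "sum f (A a \<union> (\<Union>a\<in>S. A a)) \<le> sum f (A a) + sum f (\<Union>a\<in>S. A a)"
    using insert by (subst sum_Un) auto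
  then show ?case using insert by force
qed

lemma power_add_le:
  fixes a b :: real
  assumes "0 \<le> a" "0 \<le> b" "0 < n"
  shows "a ^ n + b ^ n \<le> (a + b) ^ n"
  using assms(3)
proof (induction n rule: nat_induct_non_zero)
  case 1
  then show ?case by simp
next
  case (Suc n)
  have "a ^ Suc n + b ^ Suc n \<le> a * (a ^ n + b ^ n) + b * (a ^ n + b ^ n)"
    using assms by (simp add: algebra_simps)
  also have "\<dots> \<le> (a + b) * (a + b) ^ n"
    unfolding distrib_right[symmetric] using Suc assms by (intro mult_left_mono) auto
  finally show ?case by simp
qed

lemma prod_near_power:
  fixes u :: "'s \<Rightarrow> real"
  assumes "\<And>s. s \<in> B \<Longrightarrow> \<bar>u s\<bar> \<le> 1" and "\<bar>k\<bar> \<le> 1" and "\<And>s. s \<in> B \<Longrightarrow> \<bar>u s - k\<bar> \<le> e"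
  shows "\<bar>(\<Prod>s\<in>B. u s) - k ^ card B\<bar> \<le> real (card B) * e"
proof -
  have "\<bar>(\<Prod>s\<in>B. u s) - (\<Prod>s\<in>B. k)\<bar> \<le> (\<Sum>s\<in>B. \<bar>u s - k\<bar>)"
    using norm_prod_diff[of B u "\<lambda>_. k"] assms by simp
  also have "\<dots> \<le> (\<Sum>s\<in>B. e)" using assms by (intro sum_mono)
  finally show ?thesis by simp
qed

section \<open>Boxes as images of the discrete cube\<close>

lemma finite_d_subsets: "finite L \<Longrightarrow> finite (d_subsets d L)"
  by (rule finite_subset[of _ "Pow L"]) (auto simp: d_subsets_def)

text \<open>The box spanned by the pairs \<open>{p k False, p k True}\<close>, where \<open>k < d\<close>. Listing each pair in
increasing order turns the entries of the box into vertices of the cube \<open>{0,1}^d\<close>.\<close>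

locale box_points =
  fixes d :: nat and p :: "nat \<Rightarrow> bool \<Rightarrow> nat"
  assumes within: "k < d \<Longrightarrow> p k False < p k True"
    and between: "Suc k < d \<Longrightarrow> p k True < p (Suc k) False"
begin

definition vertex :: "(nat \<Rightarrow> bool) \<Rightarrow> nat set" where
  "vertex e = (\<lambda>k. p k (e k)) ` {..<d}"

lemma p_less:
  assumes "k < l" and "l < d"
  shows "p k a < p l b"
proof -
  have le: "p k a \<le> p k True" "p k False \<le> p k b" if "k < d" for k a b
    using within[OF that] by (cases a; cases b; simp)+
  have "p k True < p l False"
    using assms
  proof (induction l)
    case 0
    then show ?case by simp
  next
    case (Suc l)
    show ?case
    proof (cases "k = l")
      case True
      then show ?thesis using between[of l] Suc.prems by simp
    next
      case False
      then have "p k True < p l False" using Suc by simp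
      also have "\<dots> < p l True" using within[of l] Suc.prems by simp
      also have "\<dots> < p (Suc l) False" using between[of l] Suc.prems by simp
      finally show ?thesis .
    qed
  qed
  with le(1)[of k a] le(2)[of l b] assms show ?thesis by simp
qed

lemma p_eq_iff: "k < d \<Longrightarrow> l < d \<Longrightarrow> p k a = p l b \<longleftrightarrow> k = l \<and> a = b"
  using p_less[of k l a b] p_less[of l k b a] within[of k]
  by (cases k l rule: linorder_cases; cases a; cases b) auto

lemma sorted_vertex: "sorted_list_of_set (vertex e) = map (\<lambda>k. p k (e k)) [0..<d]"
proof -
  have "sorted_wrt (<) (map (\<lambda>k. p k (e k)) [0..<d])"
    by (auto simp: sorted_wrt_iff_nth_less p_less)
  moreover have "set (map (\<lambda>k. p k (e k)) [0..<d]) = vertex e"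
    by (auto simp: vertex_def)
  ultimately show ?thesis
    by (metis sorted_list_of_set.idem_if_sorted_distinct strict_sorted_iff)
qed

text \<open>The pairs follow each other, so the \<open>k\<close>-th smallest element of a vertex is the one that was
chosen from pair \<open>k\<close>. This matches the coordinates of \<open>\<omega>\<^sub>s\<close> with those of the box form.\<close>

lemma restrict_along_vertex:
  "restrict_along d w (vertex e) = (\<lambda>k\<in>{..<d}. w (p k (e k)))"
  by (auto simp: restrict_along_def sorted_vertex)

lemma card_vertex: "card (vertex e) = d"
  unfolding vertex_def by (subst card_image) (auto intro!: inj_onI simp: p_eq_iff)

lemma inj_on_vertex: "inj_on vertex ({..<d} \<rightarrow>\<^sub>E UNIV)"
proof (rule inj_onI)
  fix e e' assume e: "e \<in> {..<d} \<rightarrow>\<^sub>E (UNIV :: bool set)" "e' \<in> {..<d} \<rightarrow>\<^sub>E UNIV" "vertex e = vertex e'"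
  have "e k = e' k" if "k < d" for k
  proof -
    have "p k (e k) \<in> vertex e'" using that e(3) by (auto simp: vertex_def)
    then show ?thesis using that by (auto simp: vertex_def p_eq_iff)
  qed
  then show "e = e'" using e(1,2) by (intro PiE_ext) auto
qed

lemma vertices_eq:
  assumes "\<And>k a. k < d \<Longrightarrow> p k a \<in> I"
  shows "vertex ` ({..<d} \<rightarrow>\<^sub>E UNIV)
    = {s \<in> d_subsets d I. \<forall>k<d. card (s \<inter> {p k False, p k True}) = 1}"
proof (intro equalityI subsetI)
  fix s assume "s \<in> vertex ` ({..<d} \<rightarrow>\<^sub>E UNIV)"
  then obtain e where s: "s = vertex e" by auto
  have "vertex e \<inter> {p k False, p k True} = {p k (e k)}" if "k < d" for k
  proof -
    have "p k (e k) \<in> vertex e" using that by (auto simp: vertex_def)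
    then show ?thesis using that by (cases "e k") (auto simp: vertex_def p_eq_iff)
  qed
  then show "s \<in> {s \<in> d_subsets d I. \<forall>k<d. card (s \<inter> {p k False, p k True}) = 1}"
    using assms card_vertex[of e] by (auto simp: s d_subsets_def vertex_def)
next
  fix s assume "s \<in> {s \<in> d_subsets d I. \<forall>k<d. card (s \<inter> {p k False, p k True}) = 1}"
  then have s: "finite s" "card s = d" "\<And>k. k < d \<Longrightarrow> card (s \<inter> {p k False, p k True}) = 1"
    by (auto simp: d_subsets_def)
  define e where "e = (\<lambda>k\<in>{..<d}. p k True \<in> s)"
  have "p k (e k) \<in> s" if "k < d" for k
  proof -
    from s(3)[OF that] obtain z where z: "s \<inter> {p k False, p k True} = {z}"
      by (auto simp: card_1_singleton_iff)
    have "z \<in> s \<inter> {p k False, p k True}" unfolding z by simp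
    then show ?thesis using that by (cases "p k True \<in> s") (auto simp: e_def)
  qed
  then have "vertex e \<subseteq> s" by (auto simp: vertex_def)
  then have "vertex e = s" using s(1,2) card_vertex[of e] by (intro card_subset_eq) auto
  then show "s \<in> vertex ` ({..<d} \<rightarrow>\<^sub>E UNIV)" by (auto simp: e_def)
qed

end

lemma is_box_obtain_points:
  assumes "is_box d n B"
  obtains p where "box_points d p" "\<And>k a. k < d \<Longrightarrow> p k a \<in> {1..n}"
    "B = box_points.vertex d p ` ({..<d} \<rightarrow>\<^sub>E UNIV)"
proof -
  from assms obtain H where H: "\<forall>i\<in>{1..d}. H i \<subseteq> {1..n} \<and> card (H i) = 2"
    and H_less: "\<forall>i\<in>{1..<d}. Max (H i) < Min (H (i + 1))"
    and B: "B = {s \<in> d_subsets d {1..n}. \<forall>i\<in>{1..d}. card (s \<inter> H i) = 1}"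
    unfolding is_box_def by blast
  define p where "p k a = (if a then Max (H (Suc k)) else Min (H (Suc k)))" for k :: nat and a
  have H_eq: "H (Suc k) = {p k False, p k True} \<and> p k False < p k True" if "k < d" for k
  proof -
    have "card (H (Suc k)) = 2" using H that by simp
    then obtain x y where "H (Suc k) = {x, y}" "x \<noteq> y"
      unfolding card_2_iff by blast
    then show ?thesis by (cases "x < y") (auto simp: p_def min_def max_def)
  qed
  have p: "box_points d p"
  proof
    show "p k False < p k True" if "k < d" for k using H_eq[OF that] by simp
    show "p k True < p (Suc k) False" if "Suc k < d" for k
      using bspec[OF H_less, of "Suc k"] that by (simp add: p_def)
  qed
  have range: "p k a \<in> {1..n}" if "k < d" for k a
  proof -
    have "p k a \<in> H (Suc k)" using H_eq[OF that] by (cases a) auto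
    then show ?thesis using bspec[OF H, of "Suc k"] that by auto
  qed
  have "(\<forall>i\<in>{1..d}. card (s \<inter> H i) = 1) \<longleftrightarrow> (\<forall>k<d. card (s \<inter> {p k False, p k True}) = 1)" for s
  proof -
    have "{1..d} = Suc ` {..<d}" by (simp add: image_Suc_lessThan)
    then have "(\<forall>i\<in>{1..d}. card (s \<inter> H i) = 1) \<longleftrightarrow> (\<forall>k\<in>{..<d}. card (s \<inter> H (Suc k)) = 1)"
      by (simp del: One_nat_def)
    then show ?thesis using H_eq by (simp add: Ball_def)
  qed
  then have "B = box_points.vertex d p ` ({..<d} \<rightarrow>\<^sub>E UNIV)"
    unfolding B using box_points.vertices_eq[OF p range] by simp
  with p range show ?thesis by (rule that)
qed

lemma is_box_exists:
  assumes "2 * d \<le> n"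
  shows "\<exists>B. is_box d n B"
  unfolding is_box_def
  by (intro exI[of _ "{s \<in> d_subsets d {1..n}. \<forall>i\<in>{1..d}. card (s \<inter> {2 * i - 1, 2 * i}) = 1}"]
      exI[of _ "\<lambda>i. {2 * i - 1, 2 * i}"]) (use assms in auto)

section \<open>Laws of subarrays\<close>

lemma total_variation_ge:
  assumes "prob_space P" and "prob_space Q" and "A \<in> sets P"
  shows "\<bar>measure P A - measure Q A\<bar> \<le> total_variation P Q"
  unfolding total_variation_def
proof (rule cSUP_upper[OF assms(3)], rule bdd_aboveI2)
  fix A
  show "\<bar>measure P A - measure Q A\<bar> \<le> 1"
    using prob_space.prob_le_1[OF assms(1), of A] prob_space.prob_le_1[OF assms(2), of A]
      measure_nonneg[of P A] measure_nonneg[of Q A] by linarith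
qed

lemma subarray_law_event:
  assumes X: "random_array M \<X> d I X" and L: "finite L" "L \<subseteq> I"
    and F: "F \<subseteq> d_subsets d L" and a: "a \<in> \<X>"
  defines "A \<equiv> \<Pi>\<^sub>E s\<in>d_subsets d L. if s \<in> F then {a} else \<X>"
  shows "prob_space (subarray_law M \<X> d X L)" and "A \<in> sets (subarray_law M \<X> d X L)"
    and "measure (subarray_law M \<X> d X L) A = measure M {w \<in> space M. \<forall>s\<in>F. X s w = a}"
proof -
  let ?D = "d_subsets d L" and ?f = "\<lambda>w. \<lambda>s\<in>d_subsets d L. X s w"
  have meas: "X s \<in> M \<rightarrow>\<^sub>M count_space \<X>" if "s \<in> ?D" for s
    using X L(2) that by (auto simp: random_array_def d_subsets_def)
  have f: "?f \<in> M \<rightarrow>\<^sub>M PiM ?D (\<lambda>_. count_space \<X>)"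
    by (intro measurable_restrict meas)
  have prob: "prob_space M" using X by (simp add: random_array_def)
  show "prob_space (subarray_law M \<X> d X L)"
    unfolding subarray_law_def by (rule prob_space.prob_space_distr[OF prob f])
  have A: "A \<in> sets (PiM ?D (\<lambda>_. count_space \<X>))"
    unfolding A_def using finite_d_subsets[OF L(1)] a by (intro sets_PiM_I_finite) auto
  then show "A \<in> sets (subarray_law M \<X> d X L)" by (simp add: subarray_law_def)
  have val: "X s w \<in> \<X>" if "s \<in> ?D" "w \<in> space M" for s w
    using measurable_space[OF meas[OF that(1)] that(2)] by simp
  have "(\<forall>s\<in>?D. X s w \<in> (if s \<in> F then {a} else \<X>)) \<longleftrightarrow> (\<forall>s\<in>F. X s w = a)"
    if w: "w \<in> space M" for w
  proof (intro iffI ballI)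
    fix s assume "\<forall>s\<in>?D. X s w \<in> (if s \<in> F then {a} else \<X>)" "s \<in> F"
    then show "X s w = a" using F by fastforce
  qed (use val w in auto)
  then have "?f -` A \<inter> space M = {w \<in> space M. \<forall>s\<in>F. X s w = a}"
    by (auto simp: A_def PiE_iff)
  then show "measure (subarray_law M \<X> d X L) A = measure M {w \<in> space M. \<forall>s\<in>F. X s w = a}"
    unfolding subarray_law_def using measure_distr[OF f A] by simp
qed

lemma subarray_event_near:
  assumes X: "random_array M \<X> d I X" "L \<subseteq> I" and Y: "random_array N \<X> d I' Y" "L \<subseteq> I'"
    and L: "finite L" and F: "F \<subseteq> d_subsets d L" and a: "a \<in> \<X>"
  shows "\<bar>measure M {w \<in> space M. \<forall>s\<in>F. X s w = a} - measure N {v \<in> space N. \<forall>s\<in>F. Y s v = a}\<bar>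
    \<le> total_variation (subarray_law M \<X> d X L) (subarray_law N \<X> d Y L)"
  using total_variation_ge[OF subarray_law_event(1)[OF X(1) L X(2) F a]
      subarray_law_event(1)[OF Y(1) L Y(2) F a] subarray_law_event(2)[OF X(1) L X(2) F a]]
  by (simp add: subarray_law_event(3)[OF X(1) L X(2) F a] subarray_law_event(3)[OF Y(1) L Y(2) F a])

section \<open>The approximating mixture\<close>

context finite_prob_space
begin

lemma box_norm_eq_box_root: "box_norm d \<mu> f = box_root {..<d} f"
  by (simp add: box_norm_def box_root_def box_form_def)

text \<open>Every vertex of a random box is distributed like a random point, so a null set is avoided
by all vertices simultaneously.\<close>

lemma box_form_cong_AE:
  assumes I: "finite I" and uv: "AE v in PiM I (\<lambda>_. \<mu>). u v = u' v"
  shows "box_form I (\<lambda>_. u) = box_form I (\<lambda>_. u')"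
proof -
  let ?C = "I \<rightarrow>\<^sub>E (UNIV :: bool set)" and ?P = "PiM (I \<times> (UNIV :: bool set)) (\<lambda>_. \<mu>)"
  have "AE w in ?P. u (\<lambda>i\<in>I. w (i, e i)) = u' (\<lambda>i\<in>I. w (i, e i))" for e
  proof -
    have pr: "(\<lambda>w. \<lambda>i\<in>I. w (i, e i)) \<in> ?P \<rightarrow>\<^sub>M PiM I (\<lambda>_. \<mu>)"
      by (intro measurable_restrict measurable_component_singleton) auto
    have law: "distr ?P (PiM I (\<lambda>_. \<mu>)) (\<lambda>w. \<lambda>i\<in>I. w (i, e i)) = PiM I (\<lambda>_. \<mu>)"
      using distr_PiM_reindex[of "I \<times> UNIV" "\<lambda>_. \<mu>" "\<lambda>i. (i, e i)" I] prob_space_axioms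
      by (auto intro!: inj_onI)
    show ?thesis by (rule AE_distrD[OF pr, unfolded law, OF uv])
  qed
  then have "AE w in ?P. \<forall>e\<in>?C. u (\<lambda>i\<in>I. w (i, e i)) = u' (\<lambda>i\<in>I. w (i, e i))"
    using I by (intro AE_finite_allI) (auto simp: finite_cube)
  then have "AE w in ?P. (\<Prod>e\<in>?C. u (\<lambda>i\<in>I. w (i, e i))) = (\<Prod>e\<in>?C. u' (\<lambda>i\<in>I. w (i, e i)))"
    by eventually_elim (auto intro: prod.cong)
  then show ?thesis
    unfolding box_form_def using I by (intro integral_cong_AE) auto
qed

end

locale mixture_approximation =
  fixes d n :: nat and \<epsilon> :: real
    and \<X> :: "'x set" and M :: "'w measure" and X :: "nat set \<Rightarrow> 'w \<Rightarrow> 'x"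
    and J :: "'j set" and lam :: "'j \<Rightarrow> real" and \<mu> :: "'j \<Rightarrow> 'o measure"
    and h :: "'j \<Rightarrow> 'x \<Rightarrow> (nat \<Rightarrow> 'o) \<Rightarrow> real"
    and N :: "'v measure" and Y :: "nat set \<Rightarrow> 'v \<Rightarrow> 'x"
  assumes d_pos: "0 < d" and d_n: "2 * d \<le> n"
    and finite_\<X>: "finite \<X>"
    and array_X: "random_array M \<X> d {1..n} X"
    and finite_J: "finite J"
    and lam_pos: "\<And>j. j \<in> J \<Longrightarrow> 0 < lam j" and lam_sum: "(\<Sum>j\<in>J. lam j) = 1"
    and base: "\<And>j. j \<in> J \<Longrightarrow> finite_prob_space (\<mu> j)"
    and unity: "\<And>j. j \<in> J \<Longrightarrow> partition_of_unity \<X> d (\<mu> j) (h j)"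
    and mixture: "mixture_array N \<X> d J lam \<mu> h Y"
    and close: "\<And>L. L \<subseteq> {1..n} \<Longrightarrow> card L = 2 * d \<Longrightarrow>
      total_variation (subarray_law M \<X> d X L) (subarray_law N \<X> d Y L) \<le> \<epsilon>"
begin

abbreviation comp_mean :: "'j \<Rightarrow> 'x \<Rightarrow> real" where
  "comp_mean j a \<equiv> expect d (\<mu> j) (h j a)"

abbreviation comp_box :: "'j \<Rightarrow> 'x \<Rightarrow> real" where
  "comp_box j a \<equiv> finite_prob_space.box_form (\<mu> j) {..<d} (\<lambda>_. h j a)"

text \<open>The probability that a given entry of the mixture array equals \<open>a\<close>. It is the reference value
for all entries of \<open>X\<close> and all components of the mixture.\<close>

definition mix_mean :: "'x \<Rightarrow> real" where
  "mix_mean a = (\<Sum>j\<in>J. lam j * comp_mean j a)"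

lemma zero_index: "0 \<in> {..<d}" using d_pos by simp

lemma lam_nonneg: "j \<in> J \<Longrightarrow> 0 \<le> lam j" using lam_pos by force

lemma h_range:
  "j \<in> J \<Longrightarrow> a \<in> \<X> \<Longrightarrow> v \<in> space (PiM {..<d} (\<lambda>_. \<mu> j)) \<Longrightarrow> 0 \<le> h j a v \<and> h j a v \<le> 1"
  using unity by (auto simp: partition_of_unity_def)

lemma comp_mean_range:
  assumes "j \<in> J" "a \<in> \<X>"
  shows "0 \<le> comp_mean j a" "comp_mean j a \<le> 1"
proof -
  interpret finite_prob_space "\<mu> j" by (rule base[OF assms(1)])
  show "0 \<le> comp_mean j a" "comp_mean j a \<le> 1"
    using integral_power_mono[of "{..<d}" "\<lambda>_. 0" "h j a"]
      integral_power_mono[of "{..<d}" "h j a" "\<lambda>_. 1"] h_range[OF assms]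
    by (auto simp: expect_def)
qed

lemma comp_box_range:
  assumes "j \<in> J" "a \<in> \<X>"
  shows "comp_mean j a ^ 2 ^ d \<le> comp_box j a" "0 \<le> comp_box j a" "comp_box j a \<le> 1"
proof -
  interpret finite_prob_space "\<mu> j" by (rule base[OF assms(1)])
  note root = box_root_power[OF finite_lessThan zero_index, of "h j a"]
  have "comp_mean j a \<le> box_root {..<d} (h j a)"
    using abs_integral_le_box_root[OF finite_lessThan zero_index, of "h j a"]
    by (simp add: expect_def)
  then have "comp_mean j a ^ 2 ^ d \<le> box_root {..<d} (h j a) ^ 2 ^ d"
    using comp_mean_range[OF assms] by (intro power_mono)
  then show "comp_mean j a ^ 2 ^ d \<le> comp_box j a" using root by simp
  show "0 \<le> comp_box j a" by (rule box_form_const_nonneg[OF finite_lessThan zero_index])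
  have "box_root {..<d} (h j a) \<le> 1"
    using h_range[OF assms] by (intro box_root_le_1[OF finite_lessThan zero_index]) auto
  then have "box_root {..<d} (h j a) ^ 2 ^ d \<le> 1"
    by (intro power_le_one box_root_nonneg[OF finite_lessThan zero_index])
  then show "comp_box j a \<le> 1" using root by simp
qed

lemma mix_mean_range:
  assumes "a \<in> \<X>"
  shows "0 \<le> mix_mean a" "mix_mean a \<le> 1"
proof -
  show "0 \<le> mix_mean a"
    unfolding mix_mean_def by (intro sum_nonneg mult_nonneg_nonneg lam_nonneg comp_mean_range assms)
  have "mix_mean a \<le> (\<Sum>j\<in>J. lam j * 1)"
    unfolding mix_mean_def by (intro sum_mono mult_left_mono lam_nonneg comp_mean_range assms)
  then show "mix_mean a \<le> 1" by (simp add: lam_sum)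
qed

lemma mixture_event:
  assumes "finite F" "F \<noteq> {}" "F \<subseteq> d_subsets d {1..}" "a \<in> \<X>"
  shows "measure N {v \<in> space N. \<forall>s\<in>F. Y s v = a}
    = (\<Sum>j\<in>J. lam j * (\<integral>w. (\<Prod>s\<in>F. h j a (restrict_along d w s)) \<partial>PiM {1..} (\<lambda>_. \<mu> j)))"
proof -
  have "\<forall>F a. finite F \<and> F \<noteq> {} \<and> F \<subseteq> d_subsets d {1..} \<and> (\<forall>s\<in>F. a s \<in> \<X>) \<longrightarrow>
      measure N {v \<in> space N. \<forall>s\<in>F. Y s v = a s}
      = (\<Sum>j\<in>J. lam j * (\<integral>w. (\<Prod>s\<in>F. h j (a s) (restrict_along d w s)) \<partial>PiM {1..} (\<lambda>_. \<mu> j)))"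
    using mixture unfolding mixture_array_def by (elim conjE)
  from this[rule_format, of F "\<lambda>_. a"] show ?thesis using assms by simp
qed

lemma mixture_entry:
  assumes s: "s \<in> d_subsets d {1..}" and a: "a \<in> \<X>"
  shows "measure N {v \<in> space N. Y s v = a} = mix_mean a"
proof -
  have s': "finite s" "card s = d" "s \<subseteq> {1..}" using s by (auto simp: d_subsets_def)
  have inj: "inj_on (\<lambda>k. sorted_list_of_set s ! k) {..<d}"
    using s'(2) by (intro inj_on_nth) auto
  have range: "(\<lambda>k. sorted_list_of_set s ! k) \<in> {..<d} \<rightarrow> {1..}"
    using s' nth_mem[of _ "sorted_list_of_set s"] by fastforce
  have "measure N {v \<in> space N. \<forall>s\<in>{s}. Y s v = a}
      = (\<Sum>j\<in>J. lam j * (\<integral>w. h j a (restrict_along d w s) \<partial>PiM {1..} (\<lambda>_. \<mu> j)))"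
    by (subst mixture_event) (use s a in auto)
  also have "\<dots> = mix_mean a"
    unfolding mix_mean_def
  proof (intro sum.cong refl arg_cong2[where f="(*)"])
    fix j assume "j \<in> J"
    then interpret finite_prob_space "\<mu> j" by (rule base)
    show "(\<integral>w. h j a (restrict_along d w s) \<partial>PiM {1..} (\<lambda>_. \<mu> j)) = comp_mean j a"
      unfolding restrict_along_def expect_def
      by (rule integral_reindex_power[OF finite_lessThan inj range])
  qed
  finally show ?thesis by simp
qed

text \<open>The \<open>2 * d\<close> points of a box are distinct indices, so the coordinates that the mixture formula
inspects form a random point of \<open>\<Omega>^(2d)\<close>, and the integral is the box form of \<open>h j a\<close>.\<close>

lemma mixture_box:
  assumes p: "box_points d p" and pos: "\<And>k b. k < d \<Longrightarrow> 1 \<le> p k b" and a: "a \<in> \<X>"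
  defines "B \<equiv> box_points.vertex d p ` ({..<d} \<rightarrow>\<^sub>E UNIV)"
  shows "measure N {v \<in> space N. \<forall>s\<in>B. Y s v = a} = (\<Sum>j\<in>J. lam j * comp_box j a)"
proof -
  interpret box_points d p by (rule p)
  let ?C = "{..<d} \<rightarrow>\<^sub>E (UNIV :: bool set)"
  have inj: "inj_on (\<lambda>(k, b). p k b) ({..<d} \<times> UNIV)"
    by (auto intro!: inj_onI simp: p_eq_iff)
  have "B \<subseteq> d_subsets d {1..}"
    unfolding B_def using vertices_eq[of "{1..}"] pos by auto
  then have B: "finite B" "B \<noteq> {}" "B \<subseteq> d_subsets d {1..}"
    by (simp_all add: B_def finite_PiE PiE_eq_empty_iff)
  have "measure N {v \<in> space N. \<forall>s\<in>B. Y s v = a}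
      = (\<Sum>j\<in>J. lam j * (\<integral>w. (\<Prod>s\<in>B. h j a (restrict_along d w s)) \<partial>PiM {1..} (\<lambda>_. \<mu> j)))"
    by (rule mixture_event[OF B a])
  also have "\<dots> = (\<Sum>j\<in>J. lam j * comp_box j a)"
  proof (intro sum.cong refl arg_cong2[where f="(*)"])
    fix j assume "j \<in> J"
    then interpret finite_prob_space "\<mu> j" by (rule base)
    have point: "(\<lambda>i\<in>{..<d}. (\<lambda>q\<in>{..<d} \<times> UNIV. w (case q of (k, b) \<Rightarrow> p k b)) (i, e i))
        = restrict_along d w (vertex e)" for w :: "nat \<Rightarrow> 'o" and e
      unfolding restrict_along_vertex by (rule restrict_ext) simp
    have "(\<Prod>s\<in>B. h j a (restrict_along d w s))
        = (\<Prod>e\<in>?C. h j a (\<lambda>i\<in>{..<d}. (\<lambda>q\<in>{..<d} \<times> UNIV. w (case q of (k, b) \<Rightarrow> p k b)) (i, e i)))" for w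
      unfolding B_def prod.reindex[OF inj_on_vertex] point by simp
    then have "(\<integral>w. (\<Prod>s\<in>B. h j a (restrict_along d w s)) \<partial>PiM {1..} (\<lambda>_. \<mu> j))
        = (\<integral>w. (\<Prod>e\<in>?C. h j a (\<lambda>i\<in>{..<d}. (\<lambda>q\<in>{..<d} \<times> UNIV. w (case q of (k, b) \<Rightarrow> p k b)) (i, e i)))
            \<partial>PiM {1..} (\<lambda>_. \<mu> j))"
      by simp
    also have "\<dots> = comp_box j a"
      unfolding box_form_def
      by (rule integral_reindex_power[OF _ inj,
            where f="\<lambda>u. \<Prod>e\<in>?C. h j a (\<lambda>i\<in>{..<d}. u (i, e i))"]) (use pos in auto)
    finally show "(\<integral>w. (\<Prod>s\<in>B. h j a (restrict_along d w s)) \<partial>PiM {1..} (\<lambda>_. \<mu> j)) = comp_box j a" .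
  qed
  finally show ?thesis .
qed

lemma event_near:
  assumes L: "L \<subseteq> {1..n}" "card L = 2 * d" and F: "F \<subseteq> d_subsets d L" and a: "a \<in> \<X>"
  shows "\<bar>measure M {w \<in> space M. \<forall>s\<in>F. X s w = a} - measure N {v \<in> space N. \<forall>s\<in>F. Y s v = a}\<bar> \<le> \<epsilon>"
proof -
  have Y: "random_array N \<X> d {1..} Y" using mixture by (simp add: mixture_array_def)
  have "L \<subseteq> {1..}" "finite L" using L(1) by (auto intro: finite_subset)
  from subarray_event_near[OF array_X L(1) Y this F a] close[OF L]
  show ?thesis by linarith
qed

lemma entry_near:
  assumes L: "L \<subseteq> {1..n}" "card L = 2 * d" and s: "s \<in> d_subsets d L" and a: "a \<in> \<X>"
  shows "\<bar>measure M {w \<in> space M. X s w = a} - mix_mean a\<bar> \<le> \<epsilon>"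
proof -
  have "s \<in> d_subsets d {1..}" using s L(1) by (force simp: d_subsets_def)
  then show ?thesis using event_near[OF L, of "{s}" a] s a mixture_entry[of s a] by simp
qed

lemma first_entry_near:
  assumes "a \<in> \<X>"
  shows "\<bar>measure M {w \<in> space M. X {1..d} w = a} - mix_mean a\<bar> \<le> \<epsilon>"
  using d_n assms by (intro entry_near[of "{1..2 * d}"]) (auto simp: d_subsets_def)

text \<open>All entries of a box lie within one set of \<open>2 * d\<close> indices, so the closeness of laws controls
the joint probability and the individual probabilities alike.\<close>

lemma box_near:
  assumes B: "is_box d n B" and a: "a \<in> \<X>"
  shows "\<bar>measure M {w \<in> space M. \<forall>s\<in>B. X s w = a} - (\<Sum>j\<in>J. lam j * comp_box j a)\<bar> \<le> \<epsilon>"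
    and "\<bar>(\<Prod>s\<in>B. measure M {w \<in> space M. X s w = a}) - mix_mean a ^ 2 ^ d\<bar> \<le> 2 ^ d * \<epsilon>"
proof -
  obtain p where p: "box_points d p" and range: "\<And>k b. k < d \<Longrightarrow> p k b \<in> {1..n}"
    and B_eq: "B = box_points.vertex d p ` ({..<d} \<rightarrow>\<^sub>E UNIV)"
    using is_box_obtain_points[OF B] by blast
  interpret box_points d p by (rule p)
  define L where "L = (\<lambda>(k, b). p k b) ` ({..<d} \<times> (UNIV :: bool set))"
  have L: "L \<subseteq> {1..n}" using range by (auto simp: L_def)
  have cardL: "card L = 2 * d"
    unfolding L_def by (subst card_image) (auto intro!: inj_onI simp: p_eq_iff card_cartesian_product)
  have BL: "B \<subseteq> d_subsets d L"
    unfolding B_eq using vertices_eq[of L] by (auto simp: L_def)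
  have "measure N {v \<in> space N. \<forall>s\<in>B. Y s v = a} = (\<Sum>j\<in>J. lam j * comp_box j a)"
    unfolding B_eq using range a by (intro mixture_box[OF p]) force+
  then show "\<bar>measure M {w \<in> space M. \<forall>s\<in>B. X s w = a} - (\<Sum>j\<in>J. lam j * comp_box j a)\<bar> \<le> \<epsilon>"
    using event_near[OF L cardL BL a] by simp
  have cardB: "card B = 2 ^ d"
    unfolding B_eq by (simp add: card_image inj_on_vertex card_funcsetE)
  have prob: "prob_space M" using array_X by (simp add: random_array_def)
  have "\<bar>(\<Prod>s\<in>B. measure M {w \<in> space M. X s w = a}) - mix_mean a ^ card B\<bar> \<le> real (card B) * \<epsilon>"
    using entry_near[OF L cardL _ a] BL mix_mean_range[OF a] prob_space.prob_le_1[OF prob]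
    by (intro prod_near_power) auto
  then show "\<bar>(\<Prod>s\<in>B. measure M {w \<in> space M. X s w = a}) - mix_mean a ^ 2 ^ d\<bar> \<le> 2 ^ d * \<epsilon>"
    by (simp add: cardB)
qed

section \<open>From pseudorandom components to box independence\<close>

text \<open>For a good component the box form is within \<open>(2 ^ d - 1) * \<rho>\<close> of the power of its mean, which
in turn is within \<open>2 ^ d * (3 * \<rho>)\<close> of the power of the mixture mean, since the mixture mean
differs from \<open>\<delta>\<close> by at most \<open>2 * \<rho>\<close>. The remaining components have weight at most \<open>\<rho>\<close>, which
completes the factor \<open>2 ^ d\<close>.\<close>

lemma box_difference_le:
  assumes B: "is_box d n B" and a: "a \<in> \<X>" and \<rho>: "0 \<le> \<rho>"
    and G: "G \<subseteq> J" "1 - \<rho> \<le> (\<Sum>j\<in>G. lam j)"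
    and mean: "\<And>j. j \<in> G \<Longrightarrow> \<bar>comp_mean j a - \<delta>\<bar> \<le> \<rho>" and \<delta>: "0 \<le> \<delta>" "\<delta> \<le> 1"
    and norm: "\<And>j. j \<in> G \<Longrightarrow> box_norm d (\<mu> j) (\<lambda>w. h j a w - comp_mean j a) \<le> \<rho>"
  shows "\<bar>measure M {w \<in> space M. \<forall>s\<in>B. X s w = a} - (\<Prod>s\<in>B. measure M {w \<in> space M. X s w = a})\<bar>
    \<le> (1 + 2 ^ d) * \<epsilon> + 2 ^ d * (4 * \<rho>)"
proof -
  let ?D = "2 ^ d :: nat"
  have "\<bar>\<Sum>j\<in>J. lam j * (comp_mean j a - \<delta>)\<bar> \<le> \<rho> + \<rho>"
  proof (rule weighted_average_abs_le[OF finite_J lam_nonneg lam_sum G mean _ \<rho>])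
    show "\<bar>comp_mean j a - \<delta>\<bar> \<le> 1" if "j \<in> J" for j
      using comp_mean_range[OF that a] \<delta> by linarith
  qed
  then have avg: "\<bar>mix_mean a - \<delta>\<bar> \<le> 2 * \<rho>"
    by (simp add: mix_mean_def right_diff_distrib sum_subtractf lam_sum flip: sum_distrib_right)
  have comp: "\<bar>comp_box j a - mix_mean a ^ ?D\<bar> \<le> (2 ^ d - 1) * \<rho> + 2 ^ d * (3 * \<rho>)" if j: "j \<in> G" for j
  proof -
    have jJ: "j \<in> J" using j G by auto
    interpret finite_prob_space "\<mu> j" by (rule base[OF jJ])
    have "\<bar>comp_box j a - comp_mean j a ^ ?D\<bar>
        \<le> (2 ^ d - 1) * box_root {..<d} (\<lambda>w. h j a w - comp_mean j a)"
      using box_form_near_mean_power[OF finite_lessThan zero_index h_range[OF jJ a]]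
      by (simp add: expect_def)
    also have "\<dots> \<le> (2 ^ d - 1) * \<rho>"
      using norm[OF j] by (intro mult_left_mono) (simp_all add: box_norm_eq_box_root)
    finally have "\<bar>comp_box j a - comp_mean j a ^ ?D\<bar> \<le> (2 ^ d - 1) * \<rho>" .
    moreover have "\<bar>comp_mean j a ^ ?D - mix_mean a ^ ?D\<bar> \<le> real ?D * \<bar>comp_mean j a - mix_mean a\<bar>"
      using norm_power_diff[of "comp_mean j a" "mix_mean a" ?D] comp_mean_range[OF jJ a] mix_mean_range[OF a]
      by simp
    moreover have "real ?D * \<bar>comp_mean j a - mix_mean a\<bar> \<le> 2 ^ d * (3 * \<rho>)"
      using mean[OF j] avg by (simp add: mult_left_mono)
    ultimately show ?thesis by linarith
  qed
  have mm: "0 \<le> mix_mean a ^ ?D" "mix_mean a ^ ?D \<le> 1"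
    using mix_mean_range[OF a] by (auto intro: power_le_one)
  have "\<bar>\<Sum>j\<in>J. lam j * (comp_box j a - mix_mean a ^ ?D)\<bar> \<le> ((2 ^ d - 1) * \<rho> + 2 ^ d * (3 * \<rho>)) + \<rho>"
  proof (rule weighted_average_abs_le[OF finite_J lam_nonneg lam_sum G comp])
    show "\<bar>comp_box j a - mix_mean a ^ ?D\<bar> \<le> 1" if "j \<in> J" for j
      using comp_box_range[OF that a] mm by (simp add: abs_le_iff)
    show "0 \<le> (2 ^ d - 1) * \<rho> + 2 ^ d * (3 * \<rho>)"
      using \<rho> by (intro add_nonneg_nonneg mult_nonneg_nonneg) auto
  qed
  then have "\<bar>(\<Sum>j\<in>J. lam j * comp_box j a) - mix_mean a ^ ?D\<bar> \<le> 2 ^ d * (4 * \<rho>)"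
    by (simp add: right_diff_distrib sum_subtractf lam_sum algebra_simps flip: sum_distrib_right)
  then show ?thesis
    using box_near[OF B a] unfolding distrib_right mult_1 by linarith
qed

section \<open>From box independence to pseudorandom components\<close>

text \<open>With \<open>y = (x / 4) ^ 2 ^ d\<close> the assumption bounds the box norm of \<open>h j a\<close> by its mean plus \<open>y\<close>. The
box form of the centred function is then at most \<open>2 ^ 2 ^ d * 8 ^ d * y\<close>; dividing \<open>x\<close> by \<open>4\<close>
in \<open>y\<close> absorbs these constants, because \<open>8 ^ d \<le> 8 ^ 2 ^ d\<close>.\<close>

lemma comp_box_near_norm_le:
  assumes j: "j \<in> J" and a: "a \<in> \<X>" and x: "0 \<le> x"
    and near: "comp_box j a \<le> comp_mean j a ^ 2 ^ d + ((x / 4) ^ 2 ^ d) ^ 2 ^ d"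
  shows "box_norm d (\<mu> j) (\<lambda>w. h j a w - comp_mean j a) \<le> 4 * x"
proof -
  interpret finite_prob_space "\<mu> j" by (rule base[OF j])
  define y where "y = (x / 4) ^ 2 ^ d"
  have y: "0 \<le> y" using x by (simp add: y_def)
  let ?g = "\<lambda>w. h j a w - comp_mean j a"
  have "box_root {..<d} (h j a) ^ 2 ^ d \<le> (comp_mean j a + y) ^ 2 ^ d"
    using near power_add_le[OF comp_mean_range(1)[OF j a] y, of "2 ^ d"]
      box_root_power[OF finite_lessThan zero_index, of "h j a"] by (simp add: y_def)
  then have "box_root {..<d} (h j a) \<le> comp_mean j a + y"
    by (rule power_le_imp_le_base[where n="2 ^ d - 1", simplified])
      (use comp_mean_range[OF j a] y in simp)
  then have "box_form {..<d} (\<lambda>_. ?g) \<le> 2 ^ 2 ^ d * (4 ^ d * (2 ^ d * y))"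
    using box_form_centred_le[OF finite_lessThan zero_index h_range[OF j a] _ y]
    by (simp add: expect_def)
  also have "\<dots> = (8 ^ d / 2 ^ 2 ^ d) * x ^ 2 ^ d"
  proof -
    have "(8 :: real) ^ d = 4 ^ d * 2 ^ d" "(4 :: real) ^ 2 ^ d = 2 ^ 2 ^ d * 2 ^ 2 ^ d"
      by (simp_all flip: power_mult_distrib)
    then show ?thesis by (simp add: y_def power_divide)
  qed
  also have "\<dots> \<le> 4 ^ 2 ^ d * x ^ 2 ^ d"
  proof (intro mult_right_mono)
    have "(8 :: real) ^ d \<le> 8 ^ 2 ^ d"
      by (intro power_increasing) (auto intro: less_imp_le)
    also have "\<dots> = 4 ^ 2 ^ d * 2 ^ 2 ^ d" by (simp flip: power_mult_distrib)
    finally show "(8 :: real) ^ d / 2 ^ 2 ^ d \<le> 4 ^ 2 ^ d" by (simp add: divide_le_eq)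
  qed (use x in simp)
  finally have "box_root {..<d} ?g ^ 2 ^ d \<le> (4 * x) ^ 2 ^ d"
    using box_root_power[OF finite_lessThan zero_index, of ?g] by (simp add: power_mult_distrib)
  then show ?thesis
    unfolding box_norm_eq_box_root
    by (rule power_le_imp_le_base[where n="2 ^ d - 1", simplified]) (use x in simp)
qed

lemma comp_mean_sum:
  assumes j: "j \<in> J"
  shows "(\<Sum>a\<in>\<X>. comp_mean j a) = 1"
proof -
  interpret finite_prob_space "\<mu> j" by (rule base[OF j])
  have "(\<Sum>a\<in>\<X>. comp_mean j a) = (\<integral>v. (\<Sum>a\<in>\<X>. h j a v) \<partial>PiM {..<d} (\<lambda>_. \<mu> j))"
    by (simp add: expect_def)
  also have "\<dots> = (\<integral>v. 1 \<partial>PiM {..<d} (\<lambda>_. \<mu> j))"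
    using unity[OF j] by (intro integral_cong_AE) (auto simp: partition_of_unity_def)
  finally show ?thesis by simp
qed

text \<open>Box independence speaks about all values but one. The partition of unity passes its
consequences on to the remaining value \<open>a0\<close>.\<close>

lemma last_colour:
  assumes j: "j \<in> J" and S: "S \<subseteq> \<X>" "\<X> = insert a0 S" "a0 \<notin> S"
  shows "comp_mean j a0 = 1 - (\<Sum>a\<in>S. comp_mean j a)"
    and "box_norm d (\<mu> j) (\<lambda>w. h j a0 w - comp_mean j a0)
      \<le> (\<Sum>a\<in>S. box_norm d (\<mu> j) (\<lambda>w. h j a w - comp_mean j a))"
proof -
  interpret finite_prob_space "\<mu> j" by (rule base[OF j])
  have fin: "finite S" using S(1) finite_\<X> finite_subset by auto
  show mean0: "comp_mean j a0 = 1 - (\<Sum>a\<in>S. comp_mean j a)"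
    using comp_mean_sum[OF j] fin S by simp
  let ?u = "\<lambda>v. - (\<Sum>a\<in>S. h j a v - comp_mean j a)"
  have pointwise: "h j a0 v - comp_mean j a0 = ?u v" if "(\<Sum>a\<in>\<X>. h j a v) = 1" for v
  proof -
    have "h j a0 v = 1 - (\<Sum>a\<in>S. h j a v)" using that fin S(2,3) by simp
    then show ?thesis unfolding mean0 by (simp add: sum_subtractf)
  qed
  have "AE v in PiM {..<d} (\<lambda>_. \<mu> j). (\<Sum>a\<in>\<X>. h j a v) = 1"
    using unity[OF j] by (simp add: partition_of_unity_def)
  then have "AE v in PiM {..<d} (\<lambda>_. \<mu> j). h j a0 v - comp_mean j a0 = ?u v"
    by (rule AE_mp) (intro AE_I2 impI pointwise)
  then have "box_root {..<d} (\<lambda>v. h j a0 v - comp_mean j a0) = box_root {..<d} ?u"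
    unfolding box_root_def by (subst box_form_cong_AE) auto
  also have "\<dots> = box_root {..<d} (\<lambda>v. \<Sum>a\<in>S. h j a v - comp_mean j a)"
    by (rule box_root_uminus[OF finite_lessThan zero_index])
  also have "\<dots> \<le> (\<Sum>a\<in>S. box_root {..<d} (\<lambda>v. h j a v - comp_mean j a))"
    by (rule box_root_sum_le[OF finite_lessThan zero_index fin])
  finally show "box_norm d (\<mu> j) (\<lambda>w. h j a0 w - comp_mean j a0)
      \<le> (\<Sum>a\<in>S. box_norm d (\<mu> j) (\<lambda>w. h j a w - comp_mean j a))"
    by (simp add: box_norm_eq_box_root)
qed

text \<open>Box independence says that the average of the box forms is close to the power of the average
of the means, while every single box form dominates the power of its own mean. This is near
equality in Jensen's inequality, so most components have mean close to the average and box
form close to the power of their mean.\<close>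

lemma exceptional_weight_le:
  assumes d: "1 \<le> d" and a: "a \<in> \<X>" and B: "is_box d n B" and y: "0 < y"
    and indep: "\<bar>measure M {w \<in> space M. \<forall>s\<in>B. X s w = a}
      - (\<Prod>s\<in>B. measure M {w \<in> space M. X s w = a})\<bar> \<le> \<theta>"
  shows "(\<Sum>j | j \<in> J \<and> \<not> (\<bar>comp_mean j a - mix_mean a\<bar> \<le> y
      \<and> comp_box j a \<le> comp_mean j a ^ 2 ^ d + y ^ 2 ^ d). lam j)
    \<le> ((1 + 2 ^ d) * \<epsilon> + \<theta>) / y ^ 2 ^ d"
proof (rule concentration_of_power_means[OF finite_J lam_nonneg lam_sum _ _ _ y mix_mean_def])
  show "2 \<le> (2 :: nat) ^ d" using power_increasing[OF d, of "2 :: nat"] by simp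
  show "(\<Sum>j\<in>J. lam j * comp_box j a) \<le> mix_mean a ^ 2 ^ d + ((1 + 2 ^ d) * \<epsilon> + \<theta>)"
    using box_near[OF B a] indep unfolding distrib_right mult_1 by linarith
qed (use comp_mean_range comp_box_range a in auto)

text \<open>The exponent \<open>16 ^ d\<close> is the square of \<open>Q = 4 ^ d\<close>, whereas the threshold in Markov's inequality
costs only the power \<open>Q\<close> of \<open>x / 4\<close>. What is left over is a high power of \<open>x \<le> 1 / 8\<close>; its part
\<open>x ^ Q\<close> beats the constants \<open>4 ^ Q\<close> and \<open>1 + 2 ^ d\<close>.\<close>

lemma error_budget:
  fixes x :: real
  assumes x: "0 < x" "x \<le> 1 / 8" and d: "2 \<le> d"
  shows "(1 + 2 ^ d) * x ^ 16 ^ d \<le> x * ((x / 4) ^ 2 ^ d) ^ 2 ^ d"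
proof -
  define Q where "Q = (4 :: nat) ^ d"
  have Q: "(2 :: nat) ^ d * 2 ^ d = Q" "(16 :: nat) ^ d = Q * Q"
    by (simp_all add: Q_def flip: power_mult_distrib)
  have "4 ^ 2 \<le> Q" unfolding Q_def using d by (intro power_increasing) auto
  then have Q16: "16 \<le> Q" by simp
  then have "16 * Q \<le> Q * Q" by simp
  then have split: "Q * Q = 1 + Q + Q + (Q * Q - 1 - Q - Q)" using Q16 by linarith
  have "(4 * x) ^ Q \<le> (1 / 2) ^ Q" using x by (intro power_mono) auto
  then have half: "4 ^ Q * x ^ Q \<le> 1 / 2 ^ Q" by (simp add: power_mult_distrib power_divide)
  have "(2 :: real) ^ d \<le> Q" by (simp add: Q_def power_mono)
  moreover have "real Q + 1 \<le> 2 ^ Q"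
    using less_exp[of Q] by (metis Suc_eq_plus1 Suc_leI of_nat_1 of_nat_add of_nat_le_iff of_nat_numeral of_nat_power)
  ultimately have "1 + 2 ^ d \<le> (2 :: real) ^ Q" by linarith
  then have "(1 + 2 ^ d) * (4 ^ Q * x ^ Q) \<le> 2 ^ Q * (1 / 2 ^ Q)"
    using half x by (intro mult_mono) auto
  then have small: "(1 + 2 ^ d) * (4 ^ Q * x ^ Q) \<le> 1" by simp
  have "(1 + 2 ^ d) * x ^ 16 ^ d = (1 + 2 ^ d) * (x * x ^ Q * x ^ Q * x ^ (Q * Q - 1 - Q - Q))"
    unfolding Q(2) by (subst split) (simp only: power_add power_one_right)
  also have "\<dots> = x * ((1 + 2 ^ d) * (4 ^ Q * x ^ Q)) * (x / 4) ^ Q * x ^ (Q * Q - 1 - Q - Q)"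
    by (simp add: power_divide)
  also have "\<dots> \<le> x * 1 * (x / 4) ^ Q * 1"
    using small x by (intro mult_mono mult_left_mono) (auto intro: power_le_one)
  finally show ?thesis
    by (simp add: Q(1) flip: power_mult)
qed

text \<open>A component is discarded when it is exceptional for one of the \<open>m - 1\<close> values in \<open>S\<close>, which costs
weight \<open>x\<close> for each of them. On the other components the bounds \<open>x\<close> for the means and \<open>4 * x\<close>
for the box norms hold on \<open>S\<close>, and they hold for the last value with an additional factor
\<open>m - 1\<close>.\<close>

lemma good_components:
  assumes d: "2 \<le> d" and m: "card \<X> = m" "2 \<le> m" and \<epsilon>: "0 < \<epsilon>" "\<epsilon> \<le> 1" and \<theta>: "0 < \<theta>"
    and \<delta>: "\<And>a. a \<in> \<X> \<Longrightarrow> \<delta> a = measure M {w \<in> space M. X {1..d} w = a}"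
    and x: "x = \<epsilon> powr (1 / 16 ^ d) + \<theta> powr (1 / 16 ^ d)" and small: "4 * real m * x < 1"
    and indep: "box_independent M \<X> d n \<theta> X"
  shows "\<exists>G\<subseteq>J. 1 - 4 * real m * x \<le> (\<Sum>j\<in>G. lam j) \<and>
    (\<forall>j\<in>G. \<forall>a\<in>\<X>. \<bar>comp_mean j a - \<delta> a\<bar> \<le> 4 * real m * x \<and>
      box_norm d (\<mu> j) (\<lambda>w. h j a w - comp_mean j a) \<le> 4 * real m * x)"
proof -
  obtain S where S: "S \<subseteq> \<X>" "card S = card \<X> - 1"
    and ind: "\<And>B a. is_box d n B \<Longrightarrow> a \<in> S \<Longrightarrow> \<bar>measure M {w \<in> space M. \<forall>s\<in>B. X s w = a}
      - (\<Prod>s\<in>B. measure M {w \<in> space M. X s w = a})\<bar> \<le> \<theta>"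
    using indep unfolding box_independent_def by blast
  have finS: "finite S" using S(1) finite_\<X> finite_subset by auto
  have cardS: "real (card S) = real m - 1" using S(2) m by simp
  have "card (\<X> - S) = 1" using S m finS by (simp add: card_Diff_subset)
  then obtain a0 where "\<X> - S = {a0}" by (auto simp: card_1_singleton_iff)
  then have a0: "\<X> = insert a0 S" "a0 \<notin> S" using S(1) by auto
  obtain B where B: "is_box d n B" using is_box_exists[OF d_n] by auto
  have x_pos: "0 < x" unfolding x using \<epsilon> \<theta> by (simp add: add_pos_pos)
  have "8 * x \<le> 4 * real m * x" using m x_pos by simp
  then have x8: "x \<le> 1 / 8" using small by linarith
  define y where "y = (x / 4) ^ 2 ^ d"
  have y_pos: "0 < y" using x_pos by (simp add: y_def)
  have y_le: "y \<le> x"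
  proof -
    have "(x / 4) ^ 2 ^ d \<le> (x / 4) ^ 1" using x_pos x8 by (intro power_decreasing) auto
    then show ?thesis using x_pos by (simp add: y_def)
  qed
  \<comment> \<open>\<open>\<epsilon>\<close> and \<open>\<theta>\<close> are the powers with exponent \<open>16 ^ d\<close> of the two summands of \<open>x\<close>.\<close>
  have root_power: "(u powr (1 / 16 ^ d)) ^ 16 ^ d = u" if "0 < u" for u :: real
    using that by (simp add: powr_powr flip: powr_realpow)
  have \<epsilon>_le: "\<epsilon> \<le> x"
  proof -
    have "(\<epsilon> powr (1 / 16 ^ d)) ^ 16 ^ d \<le> (\<epsilon> powr (1 / 16 ^ d)) ^ 1"
      using \<epsilon> by (intro power_decreasing) (auto intro: powr_le1)
    then show ?thesis using \<epsilon> \<theta> by (simp add: root_power x add_increasing2)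
  qed
  have "\<epsilon> + \<theta> \<le> x ^ 16 ^ d"
    using power_add_le[of "\<epsilon> powr (1 / 16 ^ d)" "\<theta> powr (1 / 16 ^ d)" "16 ^ d"] \<epsilon> \<theta>
    by (simp add: root_power x)
  then have "(1 + 2 ^ d) * \<epsilon> + \<theta> \<le> (1 + 2 ^ d) * x ^ 16 ^ d"
  proof -
    have "(1 + 2 ^ d) * \<epsilon> + \<theta> \<le> (1 + 2 ^ d) * (\<epsilon> + \<theta>)" using \<theta> by (simp add: algebra_simps)
    also have "\<dots> \<le> (1 + 2 ^ d) * x ^ 16 ^ d"
      using \<open>\<epsilon> + \<theta> \<le> x ^ 16 ^ d\<close> by (intro mult_left_mono) auto
    finally show ?thesis .
  qed
  also have "\<dots> \<le> x * y ^ 2 ^ d" unfolding y_def by (rule error_budget[OF x_pos x8 d])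
  finally have budget: "((1 + 2 ^ d) * \<epsilon> + \<theta>) / y ^ 2 ^ d \<le> x"
    using y_pos by (simp add: divide_le_eq)
  define Bad where "Bad a = {j \<in> J. \<not> (\<bar>comp_mean j a - mix_mean a\<bar> \<le> y
      \<and> comp_box j a \<le> comp_mean j a ^ 2 ^ d + y ^ 2 ^ d)}" for a
  define G where "G = J - (\<Union>a\<in>S. Bad a)"
  have Bad: "sum lam (Bad a) \<le> x" if "a \<in> S" for a
    using exceptional_weight_le[OF _ _ B y_pos ind[OF B that]] d S(1) that budget
    unfolding Bad_def by force
  have weight: "1 - 4 * real m * x \<le> sum lam G"
  proof -
    have "sum lam (\<Union>a\<in>S. Bad a) \<le> (\<Sum>a\<in>S. sum lam (Bad a))"
      using finS finite_J lam_nonneg by (intro sum_UN_le) (auto simp: Bad_def)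
    also have "\<dots> \<le> (\<Sum>a\<in>S. x)" by (intro sum_mono Bad)
    also have "\<dots> \<le> 4 * real m * x" using x_pos cardS by simp
    finally have "sum lam (\<Union>a\<in>S. Bad a) \<le> 4 * real m * x" .
    moreover have "sum lam G = 1 - sum lam (\<Union>a\<in>S. Bad a)"
      unfolding G_def lam_sum[symmetric] using finite_J by (intro sum_diff) (auto simp: Bad_def)
    ultimately show ?thesis by simp
  qed
  have good: "\<bar>comp_mean j a - mix_mean a\<bar> \<le> (real m - 1) * x
      \<and> box_norm d (\<mu> j) (\<lambda>w. h j a w - comp_mean j a) \<le> (real m - 1) * (4 * x)"
    if j: "j \<in> G" and a: "a \<in> \<X>" for j a
  proof -
    have jJ: "j \<in> J" using j by (simp add: G_def)
    have in_S: "\<bar>comp_mean j b - mix_mean b\<bar> \<le> x"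
      "box_norm d (\<mu> j) (\<lambda>w. h j b w - comp_mean j b) \<le> 4 * x" if "b \<in> S" for b
    proof -
      have "j \<notin> Bad b" using j that by (auto simp: G_def)
      then have b: "\<bar>comp_mean j b - mix_mean b\<bar> \<le> y"
        "comp_box j b \<le> comp_mean j b ^ 2 ^ d + y ^ 2 ^ d"
        using jJ by (auto simp: Bad_def)
      show "\<bar>comp_mean j b - mix_mean b\<bar> \<le> x" using b(1) y_le by simp
      show "box_norm d (\<mu> j) (\<lambda>w. h j b w - comp_mean j b) \<le> 4 * x"
        using b(2) jJ S(1) that x_pos unfolding y_def by (intro comp_box_near_norm_le) auto
    qed
    show ?thesis
    proof (cases "a \<in> S")
      case True
      have "x \<le> (real m - 1) * x" "4 * x \<le> (real m - 1) * (4 * x)" using m x_pos by simp_all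
      then show ?thesis using in_S[OF True] by linarith
    next
      case False
      then have a: "a = a0" using \<open>a \<in> \<X>\<close> a0 by simp
      note last = last_colour[OF _ S(1) a0]
      have "mix_mean a0 = (\<Sum>i\<in>J. lam i - (\<Sum>b\<in>S. lam i * comp_mean i b))"
        unfolding mix_mean_def
        by (intro sum.cong refl) (simp add: last(1) right_diff_distrib sum_distrib_left)
      also have "\<dots> = 1 - (\<Sum>b\<in>S. mix_mean b)"
        unfolding mix_mean_def sum_subtractf lam_sum by (subst sum.swap) simp
      finally have "comp_mean j a0 - mix_mean a0 = (\<Sum>b\<in>S. mix_mean b - comp_mean j b)"
        by (simp add: last(1)[OF jJ] sum_subtractf)
      also have "\<bar>\<dots>\<bar> \<le> (\<Sum>b\<in>S. x)"
        using in_S(1) by (intro order_trans[OF sum_abs] sum_mono) (simp add: abs_minus_commute)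
      finally have "\<bar>comp_mean j a0 - mix_mean a0\<bar> \<le> (real m - 1) * x" by (simp add: cardS)
      moreover have "box_norm d (\<mu> j) (\<lambda>w. h j a0 w - comp_mean j a0) \<le> (\<Sum>b\<in>S. 4 * x)"
        using in_S(2) by (intro order_trans[OF last(2)[OF jJ]] sum_mono)
      ultimately show ?thesis by (simp add: a cardS)
    qed
  qed
  show ?thesis
  proof (intro exI[of _ G] conjI ballI weight)
    show "G \<subseteq> J" by (auto simp: G_def)
    fix j a assume j: "j \<in> G" and a: "a \<in> \<X>"
    have "\<bar>comp_mean j a - \<delta> a\<bar> \<le> (real m - 1) * x + x"
      using good[OF j a] first_entry_near[OF a] \<delta>[OF a] \<epsilon>_le by linarith
    also have "\<dots> \<le> 4 * real m * x" using x_pos by (simp add: algebra_simps)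
    finally show "\<bar>comp_mean j a - \<delta> a\<bar> \<le> 4 * real m * x" .
    have "(real m - 1) * (4 * x) \<le> 4 * real m * x" using x_pos by (simp add: algebra_simps)
    then show "box_norm d (\<mu> j) (\<lambda>w. h j a w - comp_mean j a) \<le> 4 * real m * x"
      using good[OF j a] by linarith
  qed
qed

end

lemma iterated_exp_ge:
  assumes "0 \<le> x"
  shows "x + real k \<le> (exp ^^ k) x"
proof (induction k)
  case 0
  then show ?case by simp
next
  case (Suc k)
  have "1 + (exp ^^ k) x \<le> exp ((exp ^^ k) x)" by (rule exp_ge_add_one_self)
  then have "x + real k + 1 \<le> exp ((exp ^^ k) x)" using Suc by linarith
  then show ?case by (simp add: add.assoc add.commute)
qed

text \<open>In part (i) the bound \<open>(1 + 2 ^ d) * \<epsilon>\<close> is weakened to \<open>2 ^ d * (2 * \<epsilon>)\<close>, and any set \<open>S\<close> of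
\<open>card \<X> - 1\<close> values serves, as the comparison holds for every value.\<close>

theorem proposition8p3:
  fixes d m n :: nat and \<epsilon> C :: real
    and \<X> :: "'x set" and M :: "'w measure" and X :: "nat set \<Rightarrow> 'w \<Rightarrow> 'x" and \<delta> :: "'x \<Rightarrow> real"
    and J :: "'j set" and \<Omega> :: "'o set"
    and lam :: "'j \<Rightarrow> real" and \<mu> :: "'j \<Rightarrow> 'o measure"
    and h :: "'j \<Rightarrow> 'x \<Rightarrow> (nat \<Rightarrow> 'o) \<Rightarrow> real"
    and N :: "'v measure" and Y :: "nat set \<Rightarrow> 'v \<Rightarrow> 'x"
  assumes "2 \<le> d" and "2 \<le> m"
    and "0 < \<epsilon>" and "\<epsilon> \<le> 1"
    and "C = (exp ^^ (2 * d)) (2 ^ 8 * real m ^ (7 * (2 * d) ^ d) / \<epsilon>\<^sup>2)"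
    and "C \<le> real n"
    and "finite \<X>" and "card \<X> = m"
    and "random_array M \<X> d {1..n} X"
    and "spreadable M \<X> d {1..n} (1 / C) X"
    and "\<And>a. a \<in> \<X> \<Longrightarrow> \<delta> a = measure M {w \<in> space M. X {1..d} w = a}"
    and "finite J" and "J \<noteq> {}" and "real (card J) \<le> C"
    and "finite \<Omega>" and "\<Omega> \<noteq> {}" and "real (card \<Omega>) \<le> C"
    and "\<And>j. j \<in> J \<Longrightarrow> 0 < lam j" and "(\<Sum>j\<in>J. lam j) = 1"
    and "\<And>j. j \<in> J \<Longrightarrow> prob_space (\<mu> j)"
    and "\<And>j. j \<in> J \<Longrightarrow> space (\<mu> j) = \<Omega>"
    and "\<And>j. j \<in> J \<Longrightarrow> sets (\<mu> j) = Pow \<Omega>"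
    and "\<And>j. j \<in> J \<Longrightarrow> partition_of_unity \<X> d (\<mu> j) (h j)"
    and "mixture_array N \<X> d J lam \<mu> h Y"
    and "\<And>L. L \<subseteq> {1..n} \<Longrightarrow> card L = 2 * d \<Longrightarrow>
           total_variation (subarray_law M \<X> d X L) (subarray_law N \<X> d Y L) \<le> \<epsilon>"
  shows
    "(\<forall>\<rho> \<theta>. 0 < \<rho> \<and> \<theta> = 2 ^ d * (2 * \<epsilon> + 4 * \<rho>) \<and>
        (\<exists>G\<subseteq>J. (\<Sum>j\<in>G. lam j) \<ge> 1 - \<rho> \<and>
           (\<forall>j\<in>G. \<forall>a\<in>\<X>. \<bar>expect d (\<mu> j) (h j a) - \<delta> a\<bar> \<le> \<rho> \<and>
              box_norm d (\<mu> j) (\<lambda>w. h j a w - expect d (\<mu> j) (h j a)) \<le> \<rho>))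
        \<longrightarrow> box_independent M \<X> d n \<theta> X)
     \<and>
     (\<forall>\<rho> \<theta>. 0 < \<theta> \<and> \<theta> \<le> 1 \<and>
        \<rho> = 4 * real m * (\<epsilon> powr (1 / 16 ^ d) + \<theta> powr (1 / 16 ^ d)) \<and>
        box_independent M \<X> d n \<theta> X
        \<longrightarrow> (\<exists>G\<subseteq>J. (\<Sum>j\<in>G. lam j) \<ge> 1 - \<rho> \<and>
           (\<forall>j\<in>G. \<forall>a\<in>\<X>. \<bar>expect d (\<mu> j) (h j a) - \<delta> a\<bar> \<le> \<rho> \<and>
              box_norm d (\<mu> j) (\<lambda>w. h j a w - expect d (\<mu> j) (h j a)) \<le> \<rho>)))"
proof -
  define z where "z = 2 ^ 8 * real m ^ (7 * (2 * d) ^ d) / \<epsilon>\<^sup>2"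
  have "z + real (2 * d) \<le> C"
    unfolding assms(5) z_def by (intro iterated_exp_ge) simp
  moreover have "0 \<le> z" by (simp add: z_def)
  ultimately have "real (2 * d) \<le> real n" using assms(6) by linarith
  \<comment> \<open>So there is room for a box in \<open>{1..n}\<close>.\<close>
  then have n: "2 * d \<le> n" by (simp only: of_nat_le_iff)
  interpret mixture_approximation d n \<epsilon> \<X> M X J lam \<mu> h N Y
  proof (rule mixture_approximation.intro)
    show "finite_prob_space (\<mu> j)" if "j \<in> J" for j
      using that assms(15,20,21,22)
      by (intro finite_prob_space.intro finite_prob_space_axioms.intro) auto
    show "0 < d" using assms(1) by simp
  qed (fact n assms)+
  have prob_M: "prob_space M" using assms(9) by (simp add: random_array_def)
  show ?thesis
  proof (intro conjI allI impI; elim conjE exE)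
    fix \<rho> \<theta> G
    assume \<rho>: "0 < \<rho>" and \<theta>: "\<theta> = 2 ^ d * (2 * \<epsilon> + 4 * \<rho>)" and G: "G \<subseteq> J" "1 - \<rho> \<le> (\<Sum>j\<in>G. lam j)"
      and good: "\<forall>j\<in>G. \<forall>a\<in>\<X>. \<bar>expect d (\<mu> j) (h j a) - \<delta> a\<bar> \<le> \<rho> \<and>
        box_norm d (\<mu> j) (\<lambda>w. h j a w - expect d (\<mu> j) (h j a)) \<le> \<rho>"
    obtain S where S: "S \<subseteq> \<X>" "card S = card \<X> - 1"
      using obtain_subset_with_card_n[of "card \<X> - 1" \<X>] by auto
    have "(1 + 2 ^ d) * \<epsilon> \<le> (2 ^ d + 2 ^ d) * \<epsilon>"
      using assms(3) by (intro mult_right_mono) auto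
    then have bound: "(1 + 2 ^ d) * \<epsilon> + 2 ^ d * (4 * \<rho>) \<le> \<theta>"
      by (simp add: \<theta> algebra_simps)
    show "box_independent M \<X> d n \<theta> X"
      unfolding box_independent_def
    proof (intro exI[of _ S] conjI allI impI S; elim conjE)
      fix B a assume B: "is_box d n B" and "a \<in> S"
      then have a: "a \<in> \<X>" using S by auto
      have "0 \<le> \<delta> a" "\<delta> a \<le> 1"
        using assms(11)[OF a] prob_space.prob_le_1[OF prob_M] by simp_all
      then show "\<bar>measure M {w \<in> space M. \<forall>s\<in>B. X s w = a}
          - (\<Prod>s\<in>B. measure M {w \<in> space M. X s w = a})\<bar> \<le> \<theta>"
        using good a \<rho> by (intro order_trans[OF box_difference_le[OF B a _ G] bound]) auto
    qed
  next
    fix \<rho> \<theta> :: real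
    assume \<theta>: "0 < \<theta>" and indep: "box_independent M \<X> d n \<theta> X"
      and \<rho>: "\<rho> = 4 * real m * (\<epsilon> powr (1 / 16 ^ d) + \<theta> powr (1 / 16 ^ d))"
    show "\<exists>G\<subseteq>J. (\<Sum>j\<in>G. lam j) \<ge> 1 - \<rho> \<and>
        (\<forall>j\<in>G. \<forall>a\<in>\<X>. \<bar>expect d (\<mu> j) (h j a) - \<delta> a\<bar> \<le> \<rho> \<and>
          box_norm d (\<mu> j) (\<lambda>w. h j a w - expect d (\<mu> j) (h j a)) \<le> \<rho>)"
    proof (cases "\<rho> < 1")
      case True
      then show ?thesis
        unfolding \<rho>
        by (intro good_components[OF assms(1,8,2,3,4) \<theta> assms(11) refl _ indep])
    next
      case False
      \<comment> \<open>The weight bound is vacuous.\<close>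
      then show ?thesis by (intro exI[of _ "{}"]) simp
    qed
  qed
qed

end
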